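(* Let $r:\mathbb{R}^d\to\mathbb{R}\cup\{\infty\}$ be a closed convex function, let $g:\mathbb{R}^d\to\mathbb{R}$ be $C^1$-smooth with $\rho$-Lipschitz gradient, and set $\varphi:=g+r$. Assume (A1), (A2) and $\overline{(A3)}$ stated in the context. Let $x_0\in\mathrm{dom}\, r$ and let $T\ge 0$ be an integer. (i) Fix a real $\hat\rho>\rho$ and a stepsize sequence $\alpha_t\in(0,\hat\rho^{-1}]$. Then the point $x_{t^*}$ returned by the proximal stochastic gradient method described in the context satisfies $$\mathbb{E}\left[\|\nabla\varphi_{1/\hat\rho}(x_{t^*})\|^2\right]\le\frac{2\hat\rho}{\hat\rho-\rho}\cdot\frac{\left(\varphi_{1/\hat\rho}(x_0)-\min\varphi\right)+\frac{\hat\rho\sigma^2}{2}\sum_{t=0}^T\alpha_t^2}{\sum_{t=0}^T\alpha_t}.$$ (ii) In particular, if $\rho>0$ and the constant stepsize $\alpha_t=\alpha=\frac{\gamma}{\sqrt{T+1}}$ is used for some real $\gamma\in(0,\frac{1}{2\rho}]$, then $$\mathbb{E}\left[\|\nabla\varphi_{1/(2\rho)}(x_{t^*})\|^2\right]\le 4\cdot\frac{\left(\varphi_{1/(2\rho)}(x_0)-\min\varphi\right)+\rho\sigma^2\gamma^2}{\gamma\sqrt{T+1}}.$$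
   Context: Norms are Euclidean. For a function $f$ and $\lambda>0$, $\mathrm{prox}_{\lambda f}(x):=\mathrm{argmin}_y\{f(y)+\frac{1}{2\lambda}\|y-x\|^2\}$. The Moreau envelope is $\varphi_\lambda(x):=\min_y\{\varphi(y)+\frac{1}{2\lambda}\|y-x\|^2\}$. Since $\nabla g$ is $\rho$-Lipschitz, $g+\frac{\rho}{2}\|\cdot\|^2$ is convex, and for $\lambda<\rho^{-1}$ (any $\lambda>0$ if $\rho=0$) the envelope $\varphi_\lambda$ is $C^1$ with $\nabla\varphi_\lambda(x)=\lambda^{-1}(x-\mathrm{prox}_{\lambda\varphi}(x))$. $\min\varphi$ denotes the minimum value of $\varphi$, assumed to exist. Stochastic oracle: fix a probability space $(\Omega,\mathcal{F},P)$ and equip $\mathbb{R}^d$ with the Borel $\sigma$-algebra. Assumptions: (A1) It is possible to generate i.i.d. realizations $\xi_0,\xi_1,\ldots\sim P$. (A2) There is an open set $U$ containing $\mathrm{dom}\, r$ and a measurable mapping $G:U\times\Omega\to\mathbb{R}^d$ with $\mathbb{E}_\xi[G(x,\xi)]=\nabla g(x)$ for all $x\in U$. $\overline{(A3)}$ There is a real $\sigma\ge 0$ such that $\mathbb{E}_\xi[\|G(x,\xi)-\nabla g(x)\|^2]\le\sigma^2$ for all $x\in\mathrm{dom}\, r$. Proximal stochastic gradient method: given $x_0\in\mathrm{dom}\, r$ and positive stepsizes $\alpha_t$, for $t=0,\ldots,T$ sample $\xi_t\sim P$ (independently) and set $x_{t+1}=\mathrm{prox}_{\alpha_t r}(x_t-\alpha_tG(x_t,\xi_t))$.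 Then sample $t^*\in\{0,\ldots,T\}$, independently of the $\xi_t$, with $\mathbb{P}(t^*=t)=\alpha_t/\sum_{s=0}^T\alpha_s$, and return $x_{t^*}$. The expectation is over all this randomness. *)

theory Defs
  imports "HOL-Probability.Probability"
begin

text \<open>Functions with values in \<open>\<real> \<union> {\<infinity>}\<close> are modelled as \<open>ereal\<close>-valued functions
  that never take the value \<open>-\<infinity>\<close>.\<close>

definition edom :: "('a \<Rightarrow> ereal) \<Rightarrow> 'a set" where
  "edom f = {x. f x < \<infinity>}"

definition epi :: "('a \<Rightarrow> ereal) \<Rightarrow> ('a \<times> real) set" where
  "epi f = {(x, t). f x \<le> ereal t}"

text \<open>A function is closed (equivalently, lower semicontinuous) resp. convex if its epigraph is.\<close>

definition closed_convex_fun :: "('a::euclidean_space \<Rightarrow> ereal) \<Rightarrow> bool" where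
  "closed_convex_fun f \<longleftrightarrow> (\<forall>x. f x \<noteq> -\<infinity>) \<and> closed (epi f) \<and> convex (epi f)"

definition gradient :: "('a::euclidean_space \<Rightarrow> real) \<Rightarrow> 'a \<Rightarrow> 'a" where
  "gradient f x = (THE D. GDERIV f x :> D)"

definition C1_smooth :: "('a::euclidean_space \<Rightarrow> real) \<Rightarrow> bool" where
  "C1_smooth f \<longleftrightarrow> (\<forall>x. f differentiable (at x)) \<and> continuous_on UNIV (gradient f)"

text \<open>The minimum (not merely the infimum) of the values of \<open>f\<close>; it is unspecified if
  the infimum is not attained.\<close>

definition min_value :: "('a \<Rightarrow> ereal) \<Rightarrow> ereal" where
  "min_value f = (LEAST v. v \<in> range f)"

definition prox_objective :: "real \<Rightarrow> ('a::euclidean_space \<Rightarrow> ereal) \<Rightarrow> 'a \<Rightarrow> 'a \<Rightarrow> ereal" where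
  "prox_objective lam f x y = f y + ereal (1 / (2 * lam) * (norm (y - x))\<^sup>2)"

text \<open>\<open>prox lam f\<close> is the map usually written with the product \<open>lam \<cdot> f\<close> as a subscript.\<close>

definition prox :: "real \<Rightarrow> ('a::euclidean_space \<Rightarrow> ereal) \<Rightarrow> 'a \<Rightarrow> 'a" where
  "prox lam f x = arg_min (prox_objective lam f x) (\<lambda>_. True)"

text \<open>The minimum is a real number whenever \<open>f\<close> is finite somewhere, never \<open>-\<infinity>\<close>, and the
  minimum is attained; the conversion to \<open>real\<close> makes differentiation available.\<close>

definition moreau_envelope :: "real \<Rightarrow> ('a::euclidean_space \<Rightarrow> ereal) \<Rightarrow> 'a \<Rightarrow> real" where
  "moreau_envelope lam f x = real_of_ereal (min_value (prox_objective lam f x))"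

text \<open>The oracle \<open>G\<close> only matters on \<open>U \<times> \<Omega>\<close>, where \<open>\<Omega>\<close> is the space of \<open>P\<close>. Existence of the
  expectations is part of the assumptions.\<close>

definition unbiased_oracle ::
  "'w measure \<Rightarrow> 'a::euclidean_space set \<Rightarrow> ('a \<Rightarrow> 'w \<Rightarrow> 'a) \<Rightarrow> ('a \<Rightarrow> real) \<Rightarrow> bool" where
  "unbiased_oracle P U G g \<longleftrightarrow>
     (\<lambda>(x, w). G x w) \<in> borel_measurable (restrict_space borel U \<Otimes>\<^sub>M P) \<and>
     (\<forall>x\<in>U. has_bochner_integral P (G x) (gradient g x))"

definition variance_bounded ::
  "'w measure \<Rightarrow> 'a::euclidean_space set \<Rightarrow> ('a \<Rightarrow> 'w \<Rightarrow> 'a) \<Rightarrow> ('a \<Rightarrow> real) \<Rightarrow> real \<Rightarrow> bool" where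
  "variance_bounded P D G g \<sigma> \<longleftrightarrow>
     (\<forall>x\<in>D. integrable P (\<lambda>w. (norm (G x w - gradient g x))\<^sup>2) \<and>
             (\<integral>w. (norm (G x w - gradient g x))\<^sup>2 \<partial>P) \<le> \<sigma>\<^sup>2)"

primrec prox_sgd ::
  "('a::euclidean_space \<Rightarrow> ereal) \<Rightarrow> ('a \<Rightarrow> 'w \<Rightarrow> 'a) \<Rightarrow> (nat \<Rightarrow> real) \<Rightarrow> 'a \<Rightarrow> (nat \<Rightarrow> 'w) \<Rightarrow> nat \<Rightarrow> 'a"
where
  "prox_sgd r G \<alpha> x0 \<xi> 0 = x0"
| "prox_sgd r G \<alpha> x0 \<xi> (Suc t) =
     prox (\<alpha> t) r (prox_sgd r G \<alpha> x0 \<xi> t - \<alpha> t *\<^sub>R G (prox_sgd r G \<alpha> x0 \<xi> t) (\<xi> t))"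

text \<open>The randomness of a run with \<open>T + 1\<close> samples, carried by an arbitrary probability space \<open>M\<close>:
  the samples \<open>\<xi> 0, \<dots>, \<xi> T\<close> are i.i.d. with law \<open>P\<close>, and the index \<open>tstar\<close>, with weights
  proportional to the stepsizes, is independent of the whole family of samples
  (stated for the generated \<open>\<sigma>\<close>-algebras, since the two variables take values in different types).\<close>

definition sgd_randomness ::
  "'m measure \<Rightarrow> 'w measure \<Rightarrow> nat \<Rightarrow> (nat \<Rightarrow> real) \<Rightarrow> (nat \<Rightarrow> 'm \<Rightarrow> 'w) \<Rightarrow> ('m \<Rightarrow> nat) \<Rightarrow> bool" where
  "sgd_randomness M P T \<alpha> \<xi> tstar \<longleftrightarrow>
     prob_space M \<and>
     prob_space.indep_vars M (\<lambda>_. P) \<xi> {..T} \<and>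
     (\<forall>t\<le>T. distr M P (\<xi> t) = P) \<and>
     tstar \<in> measurable M (count_space {..T}) \<and>
     (\<forall>t\<le>T. measure M {\<omega> \<in> space M. tstar \<omega> = t} = \<alpha> t / (\<Sum>s\<le>T. \<alpha> s)) \<and>
     prob_space.indep_set M
       (sets (vimage_algebra (space M) tstar (count_space {..T})))
       (sets (vimage_algebra (space M) (\<lambda>\<omega>. \<lambda>t\<in>{..T}. \<xi> t \<omega>) (Pi\<^sub>M {..T} (\<lambda>_. P))))"

end

theory Submission
  imports Defs
begin

text \<open>
  The Moreau envelope \<open>\<phi>\<^sub>\<lambda>\<close> with \<open>\<lambda> = 1 / \<rho>hat\<close> serves as a Lyapunov function. Write \<open>p\<close> for the proximal
  point of the current iterate \<open>x\<close> with respect to \<open>\<phi>\<close>. As a competitor in the problem that defines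
  the envelope at the next iterate \<open>x'\<close>, the point \<open>p\<close> yields
  \<open>\<phi>\<^sub>\<lambda> x' \<le> \<phi> p + (\<rho>hat / 2) \<parallel>x' - p\<parallel>\<^sup>2\<close>, whereas \<open>\<phi>\<^sub>\<lambda> x = \<phi> p + (\<rho>hat / 2) \<parallel>x - p\<parallel>\<^sup>2\<close>. So the envelope
  decreases as soon as a step brings the iterate closer to \<open>p\<close> on average.

  It does, because \<open>p\<close> itself is a proximal point of \<open>r\<close>: the optimality condition of \<open>p\<close> says that
  \<open>\<rho>hat (x - p) - \<nabla>g p\<close> is a subgradient of \<open>r\<close> at \<open>p\<close> (\<open>prox_sum_subgradient\<close>). Both \<open>x'\<close> and \<open>p\<close> are thus
  images under the nonexpansive proximal map of \<open>a r\<close> (\<open>resolvent_nonexpansive\<close>), and the distance of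
  their preimages is the norm of a deterministic vector minus \<open>a\<close> times the noise. The deterministic
  vector has norm at most \<open>(1 - a (\<rho>hat - \<rho>)) \<parallel>x - p\<parallel>\<close> (\<open>norm_drift\<close>); the noise has mean zero and variance at
  most \<open>\<sigma>\<^sup>2\<close>. Hence, conditionally on \<open>x\<close>, the expectation of \<open>\<parallel>x' - p\<parallel>\<^sup>2\<close> is at most
  \<open>(1 - a (\<rho>hat - \<rho>)) \<parallel>x - p\<parallel>\<^sup>2 + a\<^sup>2 \<sigma>\<^sup>2\<close> (\<open>expected_step\<close>).

  The gradient of the envelope at \<open>x\<close> is \<open>\<rho>hat (x - p)\<close> (\<open>GDERIV_env\<close>), so each step decreases the
  expected envelope by a multiple of \<open>a \<parallel>\<nabla>\<phi>\<^sub>\<lambda> x\<parallel>\<^sup>2\<close>, up to a noise term. Since the envelope stays above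
  \<open>min \<phi>\<close>, the sum of these decreases is bounded (\<open>telescoped_decrease\<close>), and drawing the returned index
  with weights proportional to the stepsizes turns the sum into the expectation that is to be
  bounded (\<open>expected_gradient_bound\<close>).
\<close>

section \<open>Gradients\<close>

lemma gradient_eq:
  assumes "GDERIV f x :> D"
  shows "gradient f x = D"
  unfolding gradient_def
proof (rule the_equality[where a = D])
  show "GDERIV f x :> D" by fact
next
  fix D' assume "GDERIV f x :> D'"
  then have "(\<lambda>h. h \<bullet> D') = (\<lambda>h. h \<bullet> D)"
    using assms unfolding gderiv_def by (rule has_derivative_unique)
  then have "h \<bullet> (D' - D) = 0" for h
    by (metis inner_diff_right diff_self)
  then show "D' = D"
    using inner_eq_zero_iff[of "D' - D"] by auto
qed

text \<open>By Riesz representation, a Frechet derivative into \<open>\<real>\<close> is the inner product with a vector,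
  namely the adjoint of the derivative evaluated at \<open>1\<close>.\<close>

lemma GDERIV_gradient:
  assumes "f differentiable at x"
  shows "GDERIV f x :> gradient f x"
proof -
  obtain f' where f': "(f has_derivative f') (at x)"
    using assms unfolding differentiable_def by blast
  then have "f' = (\<lambda>h. h \<bullet> adjoint f' 1)"
    using adjoint_works[OF has_derivative_linear[OF f'], of _ 1] by (simp add: fun_eq_iff)
  then have "GDERIV f x :> adjoint f' 1"
    using f' unfolding gderiv_def by simp
  then show ?thesis using gradient_eq by metis
qed

section \<open>Subgradients of closed convex functions\<close>

text \<open>Subgradients of extended-real functions, tested only against points of the domain. All the
  inequalities can then be stated between real numbers; outside the domain the subgradient
  inequality holds trivially.\<close>

definition subgradient :: "('a::euclidean_space \<Rightarrow> ereal) \<Rightarrow> 'a \<Rightarrow> 'a \<Rightarrow> bool" where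
  "subgradient r p v \<longleftrightarrow> p \<in> edom r \<and>
     (\<forall>y\<in>edom r. real_of_ereal (r p) + v \<bullet> (y - p) \<le> real_of_ereal (r y))"

lemma subgradient_monotone:
  assumes "subgradient r p v" "subgradient r q w"
  shows "0 \<le> (v - w) \<bullet> (p - q)"
proof -
  have "real_of_ereal (r p) + v \<bullet> (q - p) \<le> real_of_ereal (r q)"
    and "real_of_ereal (r q) + w \<bullet> (p - q) \<le> real_of_ereal (r p)"
    using assms unfolding subgradient_def by auto
  then have "v \<bullet> (q - p) + w \<bullet> (p - q) \<le> 0" by linarith
  then show ?thesis by (simp add: algebra_simps)
qed

text \<open>Monotonicity gives \<open>\<parallel>p - q\<parallel>\<^sup>2 \<le> \<langle>u - w, p - q\<rangle>\<close>, and Cauchy-Schwarz does the rest. The points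
  \<open>p\<close> and \<open>q\<close> are only characterised by their subgradients, so the lemma can compare a proximal
  point of \<open>r\<close> with any point at which some subgradient of \<open>r\<close> is known. It also shows that a
  proximal point is unique.\<close>

lemma resolvent_nonexpansive:
  assumes "0 < a" and p: "subgradient r p ((1 / a) *\<^sub>R (u - p))"
    and q: "subgradient r q ((1 / a) *\<^sub>R (w - q))"
  shows "norm (p - q) \<le> norm (u - w)"
proof -
  have "0 \<le> ((1 / a) *\<^sub>R ((u - w) - (p - q))) \<bullet> (p - q)"
    using subgradient_monotone[OF p q] by (simp add: algebra_simps)
  then have "0 \<le> (u - w) \<bullet> (p - q) - (p - q) \<bullet> (p - q)"
    using \<open>0 < a\<close> by (simp add: zero_le_divide_iff inner_diff_left[symmetric])
  then have "norm (p - q) * norm (p - q) \<le> norm (u - w) * norm (p - q)"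
    using norm_cauchy_schwarz[of "u - w" "p - q"]
    by (simp add: power2_norm_eq_inner[symmetric] power2_eq_square)
  then show ?thesis
    by (metis mult_right_le_imp_le norm_ge_zero order_le_less)
qed

lemma closed_convex_fun_finite:
  assumes "closed_convex_fun r" "p \<in> edom r"
  shows "r p = ereal (real_of_ereal (r p))"
  using assms unfolding closed_convex_fun_def edom_def
  by (cases "r p") auto

lemma closed_convex_fun_segment:
  assumes r: "closed_convex_fun r" and p: "p \<in> edom r" and y: "y \<in> edom r"
    and s: "0 \<le> s" "s \<le> (1::real)"
  shows "p + s *\<^sub>R (y - p) \<in> edom r"
    and "real_of_ereal (r (p + s *\<^sub>R (y - p)))
           \<le> (1 - s) * real_of_ereal (r p) + s * real_of_ereal (r y)"
proof -
  let ?z = "p + s *\<^sub>R (y - p)"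
  let ?R = "\<lambda>x. real_of_ereal (r x)"
  have "(p, ?R p) \<in> epi r" "(y, ?R y) \<in> epi r"
    unfolding epi_def using closed_convex_fun_finite[OF r] p y by auto
  moreover have "convex (epi r)" using r unfolding closed_convex_fun_def by simp
  ultimately have "(1 - s) *\<^sub>R (p, ?R p) + s *\<^sub>R (y, ?R y) \<in> epi r"
    using s by (intro convexD) auto
  then have le: "r ?z \<le> ereal ((1 - s) * ?R p + s * ?R y)"
    unfolding epi_def by (simp add: algebra_simps)
  then show mem: "?z \<in> edom r"
    unfolding edom_def using le_less_trans by fastforce
  show "?R ?z \<le> (1 - s) * ?R p + s * ?R y"
    using le closed_convex_fun_finite[OF r mem] by (metis ereal_less_eq(3))
qed

text \<open>Fermat's rule for a smooth plus a convex function. Along the segment from the minimizer \<open>p\<close> to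
  \<open>y\<close>, convexity bounds the change of \<open>r\<close> by \<open>s (r y - r p)\<close>, so the difference quotients of \<open>F\<close>
  are at least \<open>r p - r y\<close>; in the limit the directional derivative of \<open>F\<close> is too.
  The function \<open>F\<close> will contain the nonconvex \<open>g\<close>.\<close>

lemma subgradient_of_minimizer:
  assumes r: "closed_convex_fun r" and D: "GDERIV F p :> D" and p: "p \<in> edom r"
    and min: "\<And>y. y \<in> edom r \<Longrightarrow>
      F p + real_of_ereal (r p) \<le> F y + real_of_ereal (r y)"
  shows "subgradient r p (- D)"
  unfolding subgradient_def
proof (intro conjI ballI p)
  fix y assume y: "y \<in> edom r"
  let ?R = "\<lambda>x. real_of_ereal (r x)"
  define h where "h s = F (p + s *\<^sub>R (y - p))" for s :: real
  have "(h has_derivative (\<lambda>s. (s *\<^sub>R (y - p)) \<bullet> D)) (at 0)"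
    unfolding h_def
    by (rule has_derivative_compose[where f = "\<lambda>s. p + s *\<^sub>R (y - p)" and g = F])
       (use D in \<open>auto intro!: derivative_eq_intros simp: gderiv_def\<close>)
  then have "(h has_real_derivative ((y - p) \<bullet> D)) (at 0)"
    unfolding has_field_derivative_def by (simp add: mult_commute_abs)
  then have "((\<lambda>s. (h s - h 0) / s) \<longlongrightarrow> (y - p) \<bullet> D) (at_right 0)"
    unfolding has_field_derivative_iff by (simp add: filterlim_at_split)
  moreover have "\<forall>\<^sub>F s in at_right 0. ?R p - ?R y \<le> (h s - h 0) / s"
  proof -
    have "?R p - ?R y \<le> (h s - h 0) / s" if s: "0 < s" "s < 1" for s
    proof -
      have "h 0 + ?R p \<le> h s + ((1 - s) * ?R p + s * ?R y)"
        using min[of "p + s *\<^sub>R (y - p)"] closed_convex_fun_segment[OF r p y, of s] s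
        unfolding h_def by fastforce
      then have "s * (?R p - ?R y) \<le> h s - h 0" by (simp add: algebra_simps)
      then show ?thesis using s by (simp add: field_simps)
    qed
    then show ?thesis by (auto simp: eventually_at_right_field intro: exI[of _ 1])
  qed
  ultimately have "?R p - ?R y \<le> (y - p) \<bullet> D"
    by (rule tendsto_lowerbound) simp
  then show "?R p + - D \<bullet> (y - p) \<le> ?R y"
    by (simp add: inner_commute)
qed

section \<open>Proximal points\<close>

text \<open>The point \<open>(x\<^sub>0, r x\<^sub>0 - 1)\<close> lies strictly below the epigraph. A hyperplane separating it from the
  epigraph cannot be vertical, because the epigraph also contains \<open>(x\<^sub>0, r x\<^sub>0)\<close>; hence it is the
  graph of an affine function.\<close>

lemma closed_convex_fun_affine_minorant:
  assumes r: "closed_convex_fun r" and x0: "x0 \<in> edom r"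
  shows "\<exists>c v. \<forall>y. ereal (c + v \<bullet> y) \<le> r y"
proof -
  let ?R = "\<lambda>x. real_of_ereal (r x)"
  have fin: "r x0 = ereal (?R x0)" by (rule closed_convex_fun_finite[OF r x0])
  have "convex (epi r)" "closed (epi r)" using r unfolding closed_convex_fun_def by auto
  moreover have "(x0, ?R x0 - 1) \<notin> epi r"
    unfolding epi_def by (simp, subst fin) (simp del: real_of_ereal.simps)
  ultimately obtain z b where z: "z \<bullet> (x0, ?R x0 - 1) < b" "\<And>e. e \<in> epi r \<Longrightarrow> b < z \<bullet> e"
    using separating_hyperplane_closed_point by metis
  obtain a k where [simp]: "z = (a, k)" by (cases z)
  have below: "b < a \<bullet> y + k * t" if "r y \<le> ereal t" for y t
    using z(2)[of "(y, t)"] that unfolding epi_def by simp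
  have "0 < k"
    using z(1) below[of x0 "?R x0"] fin by (simp add: algebra_simps)
  have "ereal (b / k + (- (1 / k) *\<^sub>R a) \<bullet> y) \<le> r y" for y
  proof (cases "y \<in> edom r")
    case True
    then have fy: "r y = ereal (?R y)" by (rule closed_convex_fun_finite[OF r])
    then have "b < a \<bullet> y + k * ?R y" by (intro below) simp
    then have "b / k - a \<bullet> y / k \<le> ?R y" using \<open>0 < k\<close> by (simp add: field_simps)
    then show ?thesis by (subst fy) simp
  qed (simp add: edom_def)
  then show ?thesis by blast
qed

text \<open>The direct method, carried out in the epigraph: minimizing \<open>f + q\<close> amounts to minimizing the
  continuous function \<open>(y, t) \<mapsto> t + q y\<close> over the closed set \<open>epi f\<close>. The quadratic term \<open>q\<close>
  dominates the affine minorant, so the relevant sublevel set is compact. This covers both the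
  convex function \<open>r\<close> and the nonconvex sum \<open>g + r\<close>.\<close>

lemma prox_objective_attains_min:
  assumes cl: "closed (epi f)" and minor: "\<And>y. ereal (c + v \<bullet> y) \<le> f y"
    and y0: "y0 \<in> edom f" and lam: "0 < lam"
  shows "\<exists>p. \<forall>y. prox_objective lam f x p \<le> prox_objective lam f x y"
proof -
  define q where "q y = 1 / (2 * lam) * (norm (y - x))\<^sup>2" for y
  define F where "F z = snd z + q (fst z)" for z
  have fin: "\<exists>t. f y = ereal t" if "y \<in> edom f" for y
    using that minor[of y] unfolding edom_def by (cases "f y") auto
  obtain t0 where t0: "f y0 = ereal t0" using fin[OF y0] by blast
  define C where "C = F (y0, t0)"
  define S where "S = epi f \<inter> {z. F z \<le> C}"
  have contF: "continuous_on A F" for A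
    unfolding F_def q_def by (intro continuous_intros)
  have "closed S"
    unfolding S_def
    by (intro closed_Int cl closed_Collect_le contF continuous_on_const)
  \<comment> \<open>On \<open>S\<close> the distance \<open>s\<close> from \<open>y\<close> to \<open>x\<close> satisfies \<open>s\<^sup>2 \<le> 2 lam \<parallel>v\<parallel> s + 2 lam K\<close>, which forces
    \<open>s \<le> B\<close>.\<close>
  define K where "K = C - c - v \<bullet> x"
  define B where "B = 2 * lam * norm v + 2 * lam * \<bar>K\<bar> + 1"
  have "S \<subseteq> cball x B \<times> {c - norm v * (norm x + B)..C}"
  proof clarify
    fix y t assume "(y, t) \<in> S"
    then have ft: "f y \<le> ereal t" and FC: "t + q y \<le> C"
      unfolding S_def epi_def F_def by auto
    have ct: "c + v \<bullet> y \<le> t"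
      using order_trans[OF minor ft] by simp
    define s where "s = norm (y - x)"
    have "0 \<le> s" unfolding s_def by simp
    have "v \<bullet> (x - y) \<le> norm v * s"
      using norm_cauchy_schwarz[of v "x - y"] by (simp add: s_def norm_minus_commute)
    then have "q y \<le> K + norm v * s"
      using FC ct unfolding K_def by (simp add: algebra_simps)
    then have 1: "s\<^sup>2 \<le> 2 * lam * norm v * s + 2 * lam * K"
      using lam unfolding q_def s_def[symmetric] by (simp add: field_simps)
    have "s \<le> B"
    proof (rule ccontr)
      assume "\<not> s \<le> B"
      have "0 \<le> 2 * lam * norm v" "0 \<le> 2 * lam * \<bar>K\<bar>" using lam by auto
      then have "1 < s" using \<open>\<not> s \<le> B\<close> unfolding B_def by linarith
      have "B * s < s * s" using \<open>\<not> s \<le> B\<close> \<open>1 < s\<close> by simp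
      moreover have "2 * lam * K \<le> (2 * lam * \<bar>K\<bar>) * s"
      proof -
        have "2 * lam * K \<le> 2 * lam * \<bar>K\<bar>" using lam by simp
        also have "\<dots> \<le> (2 * lam * \<bar>K\<bar>) * s"
          using \<open>1 < s\<close> \<open>0 \<le> 2 * lam * \<bar>K\<bar>\<close> by (intro mult_le_cancel_left1[THEN iffD2]) auto
        finally show ?thesis .
      qed
      ultimately show False
        using 1 \<open>1 < s\<close> unfolding B_def by (simp add: algebra_simps power2_eq_square)
    qed
    have "norm y \<le> norm x + B"
      using \<open>s \<le> B\<close> norm_triangle_ineq2[of y x] unfolding s_def by linarith
    then have "\<bar>v \<bullet> y\<bar> \<le> norm v * (norm x + B)"
      using Cauchy_Schwarz_ineq2[of v y] mult_left_mono[of "norm y" "norm x + B" "norm v"] by simp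
    moreover have "0 \<le> q y" using lam unfolding q_def by simp
    ultimately show "y \<in> cball x B \<and> t \<in> {c - norm v * (norm x + B)..C}"
      using \<open>s \<le> B\<close> ct FC unfolding s_def by (auto simp: dist_norm norm_minus_commute)
  qed
  then have "bounded S"
    by (rule bounded_subset[rotated]) (intro bounded_Times bounded_cball bounded_closed_interval)
  then have "compact S" using \<open>closed S\<close> by (simp add: compact_eq_bounded_closed)
  moreover have "(y0, t0) \<in> S" unfolding S_def C_def epi_def using t0 by simp
  ultimately obtain z where z: "z \<in> S" "\<And>w. w \<in> S \<Longrightarrow> F z \<le> F w"
    using continuous_attains_inf[OF _ _ contF] by (metis empty_iff)
  have glob: "F z \<le> F w" if "w \<in> epi f" for w
  proof (cases "w \<in> S")
    case False
    then have "C < F w" using that unfolding S_def by auto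
    then show ?thesis using z(1) unfolding S_def by auto
  qed (rule z(2))
  have "prox_objective lam f x (fst z) \<le> prox_objective lam f x y" for y
  proof (cases "y \<in> edom f")
    case True
    then obtain t where t: "f y = ereal t" using fin by blast
    then have "F z \<le> t + q y" using glob[of "(y, t)"] unfolding epi_def F_def by simp
    moreover have "f (fst z) \<le> ereal (snd z)"
      using z(1) unfolding S_def epi_def by (auto simp: case_prod_unfold)
    then have "f (fst z) + ereal (q (fst z)) \<le> ereal (F z)"
      unfolding F_def plus_ereal.simps(1)[symmetric] by (rule add_right_mono)
    ultimately show ?thesis
      unfolding prox_objective_def q_def[symmetric] t
      by (metis ereal_less_eq(3) order_trans plus_ereal.simps(1))
  qed (simp add: prox_objective_def edom_def)
  then show ?thesis by blast
qed

text \<open>\<open>prox\<close> is a choice among all minimizers; uniqueness only comes with the subgradients.\<close>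

lemma prox_minimizes:
  assumes "\<exists>p. \<forall>y. prox_objective lam f x p \<le> prox_objective lam f x y"
  shows "prox_objective lam f x (prox lam f x) \<le> prox_objective lam f x y"
proof -
  obtain p where "\<forall>y. prox_objective lam f x p \<le> prox_objective lam f x y"
    using assms by blast
  then have "prox_objective lam f x (prox lam f x) = prox_objective lam f x p"
    unfolding prox_def by (intro arg_min_equality) auto
  then show ?thesis using \<open>\<forall>y. _\<close> by simp
qed

lemma moreau_envelope_eq_prox_objective:
  assumes "\<exists>p. \<forall>y. prox_objective lam f x p \<le> prox_objective lam f x y"
  shows "moreau_envelope lam f x = real_of_ereal (prox_objective lam f x (prox lam f x))"
proof -
  have "min_value (prox_objective lam f x) = prox_objective lam f x (prox lam f x)"
    unfolding min_value_def
    by (rule Least_equality) (auto simp: prox_minimizes[OF assms])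
  then show ?thesis unfolding moreau_envelope_def by simp
qed

lemma prox_sum_subgradient:
  assumes r: "closed_convex_fun r" and g: "\<And>y. GDERIV g y :> gradient g y"
    and lam: "0 < lam" and x0: "x0 \<in> edom r"
    and ex: "\<exists>p. \<forall>y. prox_objective lam (\<lambda>y. ereal (g y) + r y) x p
                        \<le> prox_objective lam (\<lambda>y. ereal (g y) + r y) x y"
  defines "p \<equiv> prox lam (\<lambda>y. ereal (g y) + r y) x"
  shows "subgradient r p ((1 / lam) *\<^sub>R (x - p) - gradient g p)"
proof -
  let ?R = "\<lambda>x. real_of_ereal (r x)"
  define F where "F y = g y + 1 / (2 * lam) * (norm (y - x))\<^sup>2" for y
  have obj: "prox_objective lam (\<lambda>y. ereal (g y) + r y) x y = ereal (F y + ?R y)"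
    if "y \<in> edom r" for y
    unfolding prox_objective_def F_def
    by (subst closed_convex_fun_finite[OF r that]) simp
  have le: "prox_objective lam (\<lambda>y. ereal (g y) + r y) x p
      \<le> prox_objective lam (\<lambda>y. ereal (g y) + r y) x y" for y
    unfolding p_def by (rule prox_minimizes[OF ex])
  have p: "p \<in> edom r"
    using le[of x0] unfolding obj[OF x0] by (cases "r p") (auto simp: edom_def prox_objective_def)
  have "F p + ?R p \<le> F y + ?R y" if "y \<in> edom r" for y
    using le[of y] obj[OF p] obj[OF that] by simp
  moreover have "GDERIV F p :> gradient g p + (1 / lam) *\<^sub>R (p - x)"
  proof -
    have "((\<lambda>y. (y - x) \<bullet> (y - x)) has_derivative (\<lambda>h. (p - x) \<bullet> h + h \<bullet> (p - x))) (at p)"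
      by (rule has_derivative_inner) (auto intro!: derivative_eq_intros)
    then have "((\<lambda>y. 1 / (2 * lam) * ((y - x) \<bullet> (y - x))) has_derivative
        (\<lambda>h. 1 / (2 * lam) * ((p - x) \<bullet> h + h \<bullet> (p - x)))) (at p)"
      by (rule has_derivative_mult_right)
    moreover have "1 / (2 * lam) * ((p - x) \<bullet> h + h \<bullet> (p - x)) = h \<bullet> ((1 / lam) *\<^sub>R (p - x))" for h
      unfolding inner_commute[of "p - x" h] using lam by simp
    ultimately have "((\<lambda>y. 1 / (2 * lam) * ((y - x) \<bullet> (y - x))) has_derivative
        (\<lambda>h. h \<bullet> ((1 / lam) *\<^sub>R (p - x)))) (at p)"
      by simp
    then show ?thesis
      unfolding F_def power2_norm_eq_inner
      by (intro GDERIV_add g) (simp add: gderiv_def)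
  qed
  ultimately have "subgradient r p (- (gradient g p + (1 / lam) *\<^sub>R (p - x)))"
    using r p by (intro subgradient_of_minimizer) auto
  then show ?thesis by (simp add: algebra_simps)
qed

text \<open>The case \<open>g = 0\<close>, in which the affine minorant of \<open>r\<close> supplies the minimizer.\<close>

lemma prox_subgradient:
  assumes r: "closed_convex_fun r" and x0: "x0 \<in> edom r" and a: "0 < a"
  shows "subgradient r (prox a r u) ((1 / a) *\<^sub>R (u - prox a r u))"
proof -
  obtain c v where "\<forall>y. ereal (c + v \<bullet> y) \<le> r y"
    using closed_convex_fun_affine_minorant[OF r x0] by blast
  then have ex: "\<exists>p. \<forall>y. prox_objective a r u p \<le> prox_objective a r u y"
    using r x0 a by (intro prox_objective_attains_min) (auto simp: closed_convex_fun_def)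
  have [simp]: "gradient (\<lambda>_::'a. 0::real) y = 0" for y :: 'a
    by (rule gradient_eq[OF GDERIV_const])
  show ?thesis
    using prox_sum_subgradient[OF r _ a x0, of "\<lambda>_. 0" u] ex
    by (simp add: GDERIV_const zero_ereal_def[symmetric])
qed

section \<open>The Moreau envelope of a smooth plus a convex function\<close>

text \<open>The parameter \<open>\<rho>hat\<close> is the reciprocal of the parameter of the Moreau
  envelope.\<close>

locale composite_problem =
  fixes r :: "'a::euclidean_space \<Rightarrow> ereal" and g :: "'a \<Rightarrow> real" and \<rho> \<rho>hat :: real and \<phi>
  assumes r: "closed_convex_fun r" and edom_nonempty: "edom r \<noteq> {}"
    and g: "C1_smooth g" and lipschitz: "\<rho>-lipschitz_on UNIV (gradient g)"
    and \<phi>: "\<phi> = (\<lambda>x. ereal (g x) + r x)"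
    and min_exists: "\<exists>z. \<forall>y. \<phi> z \<le> \<phi> y"
    and \<rho>hat: "\<rho> < \<rho>hat"
begin

abbreviation "R x \<equiv> real_of_ereal (r x)"
abbreviation "phat \<equiv> prox (1 / \<rho>hat) \<phi>"
abbreviation "env \<equiv> moreau_envelope (1 / \<rho>hat) \<phi>"

lemma rho_nonneg: "0 \<le> \<rho>" and rhohat_pos: "0 < \<rho>hat"
  using lipschitz_on_nonneg[OF lipschitz] \<rho>hat by auto

lemma gradient_lipschitz: "norm (gradient g x - gradient g y) \<le> \<rho> * norm (x - y)"
  using lipschitz_onD[OF lipschitz, of x y] by (simp add: dist_norm)

lemma GDERIV_g: "GDERIV g x :> gradient g x"
  using g unfolding C1_smooth_def by (intro GDERIV_gradient) blast

lemma phi_eq: "y \<in> edom r \<Longrightarrow> \<phi> y = ereal (g y + R y)"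
  unfolding \<phi> by (subst closed_convex_fun_finite[OF r]) auto

lemma min_value_le:
  assumes "y \<in> edom r"
  shows "real_of_ereal (min_value \<phi>) \<le> g y + R y"
proof -
  obtain z where z: "\<And>y. \<phi> z \<le> \<phi> y" using min_exists by blast
  then have mz: "min_value \<phi> = \<phi> z"
    unfolding min_value_def by (intro Least_equality) auto
  have "\<phi> z \<le> ereal (g y + R y)" using z[of y] phi_eq[OF assms] by simp
  then have "z \<in> edom r" unfolding \<phi> edom_def by (cases "r z") auto
  then have fz: "\<phi> z = ereal (g z + R z)" by (rule phi_eq)
  show ?thesis
    using z[of y] mz fz phi_eq[OF assms] by simp
qed

lemma closed_epi_phi: "closed (epi \<phi>)"
proof -
  have "continuous_on UNIV g"
    using g unfolding C1_smooth_def
    by (simp add: continuous_on_eq_continuous_within differentiable_imp_continuous_within)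
  then have "continuous_on UNIV (\<lambda>z. (fst z, snd z - g (fst z)))"
    by (auto intro!: continuous_intros continuous_on_compose2[of UNIV g])
  then have "closed ((\<lambda>z. (fst z, snd z - g (fst z))) -` epi r)"
    using r by (intro continuous_closed_vimage)
      (auto simp: closed_convex_fun_def continuous_on_eq_continuous_within)
  also have "(\<lambda>z. (fst z, snd z - g (fst z))) -` epi r = epi \<phi>"
  proof -
    have "r x \<le> ereal (t - g x) \<longleftrightarrow> ereal (g x) + r x \<le> ereal t" for x t
      by (cases "r x") auto
    then show ?thesis unfolding epi_def \<phi> by (auto simp: case_prod_unfold)
  qed
  finally show ?thesis .
qed

text \<open>The minimum of \<open>\<phi>\<close> is a constant, hence affine, minorant.\<close>

lemma phat_attained:
  "\<exists>p. \<forall>y. prox_objective (1 / \<rho>hat) \<phi> x p \<le> prox_objective (1 / \<rho>hat) \<phi> x y"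
proof -
  obtain y0 where y0: "y0 \<in> edom r" using edom_nonempty by blast
  have "y0 \<in> edom \<phi>" using phi_eq[OF y0] unfolding edom_def by simp
  moreover have minor: "ereal (real_of_ereal (min_value \<phi>) + 0 \<bullet> y) \<le> \<phi> y" for y
  proof (cases "y \<in> edom r")
    case True
    then show ?thesis using min_value_le phi_eq by simp
  qed (simp add: edom_def \<phi>)
  ultimately show ?thesis
    using rhohat_pos by (intro prox_objective_attains_min[OF closed_epi_phi minor]) auto
qed

lemma phat_subgradient:
  "subgradient r (phat x) (\<rho>hat *\<^sub>R (x - phat x) - gradient g (phat x))"
proof -
  obtain y0 where "y0 \<in> edom r" using edom_nonempty by blast
  from prox_sum_subgradient[OF r GDERIV_g _ this, of "1 / \<rho>hat" x]
  show ?thesis using rhohat_pos phat_attained[of x] unfolding \<phi> by simp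
qed

lemma phat_in_edom: "phat x \<in> edom r"
  using phat_subgradient unfolding subgradient_def by blast

lemma env_eq: "env x = g (phat x) + R (phat x) + \<rho>hat / 2 * (norm (phat x - x))\<^sup>2"
  unfolding moreau_envelope_eq_prox_objective[OF phat_attained] prox_objective_def
  by (simp add: phi_eq[OF phat_in_edom])

lemma env_le:
  assumes "y \<in> edom r"
  shows "env x \<le> g y + R y + \<rho>hat / 2 * (norm (y - x))\<^sup>2"
  using prox_minimizes[OF phat_attained, of x y] env_eq[of x]
  unfolding prox_objective_def by (simp add: phi_eq[OF phat_in_edom] phi_eq[OF assms])

lemma min_value_le_env: "real_of_ereal (min_value \<phi>) \<le> env x"
proof -
  have "0 \<le> \<rho>hat / 2 * (norm (phat x - x))\<^sup>2" using rhohat_pos by simp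
  then show ?thesis using min_value_le[OF phat_in_edom, of x] env_eq[of x] by linarith
qed

text \<open>The curvature \<open>\<rho>hat\<close> of the proximal term beats the nonmonotonicity of \<open>\<nabla>g\<close>, which is at most \<open>\<rho>\<close>.\<close>

lemma phat_lipschitz: "(\<rho>hat - \<rho>) * norm (phat x - phat y) \<le> \<rho>hat * norm (x - y)"
proof -
  let ?p = "phat x" and ?q = "phat y"
  let ?d = "gradient g ?p - gradient g ?q"
  have "0 \<le> ((\<rho>hat *\<^sub>R (x - ?p) - gradient g ?p) - (\<rho>hat *\<^sub>R (y - ?q) - gradient g ?q)) \<bullet> (?p - ?q)"
    by (rule subgradient_monotone[OF phat_subgradient phat_subgradient])
  also have "\<dots> = \<rho>hat * ((x - y) \<bullet> (?p - ?q)) - \<rho>hat * ((?p - ?q) \<bullet> (?p - ?q)) - ?d \<bullet> (?p - ?q)"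
    by (simp add: algebra_simps)
  also have "\<dots> \<le> \<rho>hat * (norm (x - y) * norm (?p - ?q)) - \<rho>hat * (norm (?p - ?q) * norm (?p - ?q))
      + \<rho> * (norm (?p - ?q) * norm (?p - ?q))"
  proof -
    have "- (?d \<bullet> (?p - ?q)) \<le> norm ?d * norm (?p - ?q)"
      using Cauchy_Schwarz_ineq2[of ?d "?p - ?q"] by linarith
    also have "\<dots> \<le> \<rho> * norm (?p - ?q) * norm (?p - ?q)"
      by (intro mult_right_mono gradient_lipschitz) simp
    finally have "- (?d \<bullet> (?p - ?q)) \<le> \<rho> * (norm (?p - ?q) * norm (?p - ?q))" by simp
    moreover have "\<rho>hat * ((x - y) \<bullet> (?p - ?q)) \<le> \<rho>hat * (norm (x - y) * norm (?p - ?q))"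
      using rhohat_pos by (intro mult_left_mono norm_cauchy_schwarz) auto
    moreover have "(?p - ?q) \<bullet> (?p - ?q) = norm (?p - ?q) * norm (?p - ?q)"
      by (simp add: dot_square_norm power2_eq_square)
    ultimately show ?thesis by simp
  qed
  finally have "((\<rho>hat - \<rho>) * norm (?p - ?q)) * norm (?p - ?q) \<le> (\<rho>hat * norm (x - y)) * norm (?p - ?q)"
    by (simp add: algebra_simps)
  then show ?thesis
    using rhohat_pos by (cases "?p = ?q") auto
qed

lemma continuous_phat: "continuous_on UNIV phat"
proof -
  have "(\<rho>hat / (\<rho>hat - \<rho>))-lipschitz_on UNIV phat"
    using phat_lipschitz \<rho>hat rhohat_pos
    by (intro lipschitz_onI) (auto simp: dist_norm field_simps)
  then show ?thesis by (rule lipschitz_on_continuous_on)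
qed

text \<open>The proximal point of \<open>x\<close> is a competitor in the problem defining the envelope at \<open>y\<close>.\<close>

lemma env_upper_tangent:
  "env y \<le> env x + \<rho>hat * ((x - phat x) \<bullet> (y - x)) + \<rho>hat / 2 * (norm (y - x))\<^sup>2"
proof -
  have "(norm (phat x - y))\<^sup>2
      = (norm (phat x - x))\<^sup>2 + 2 * ((x - phat x) \<bullet> (y - x)) + (norm (y - x))\<^sup>2"
    by (simp add: power2_norm_eq_inner algebra_simps inner_commute)
  then have "\<rho>hat / 2 * (norm (phat x - y))\<^sup>2 = \<rho>hat / 2 * (norm (phat x - x))\<^sup>2
      + \<rho>hat * ((x - phat x) \<bullet> (y - x)) + \<rho>hat / 2 * (norm (y - x))\<^sup>2"
    by (simp only:) (simp add: distrib_left)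
  then show ?thesis
    using env_le[OF phat_in_edom, of y x] env_eq[of x] by linarith
qed

text \<open>\<open>env_upper_tangent\<close> says that the envelope at \<open>y\<close> exceeds the claimed linearisation by at most a
  multiple of \<open>\<parallel>y - x\<parallel>\<^sup>2\<close>. With the roles of \<open>x\<close> and \<open>y\<close> exchanged it becomes a lower bound whose
  slope belongs to \<open>y\<close>; since the proximal map is Lipschitz, replacing this slope by the one at \<open>x\<close>
  costs again only a multiple of \<open>\<parallel>y - x\<parallel>\<^sup>2\<close>.\<close>

lemma GDERIV_env: "GDERIV env x :> \<rho>hat *\<^sub>R (x - phat x)"
proof -
  define L where "L = \<rho>hat / (\<rho>hat - \<rho>)"
  define K where "K = \<rho>hat * (L + 1)"
  have "0 < L" unfolding L_def using \<rho>hat rhohat_pos by simp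
  then have "0 < K" unfolding K_def using rhohat_pos by simp
  have key: "norm (env y - env x - (y - x) \<bullet> (\<rho>hat *\<^sub>R (x - phat x))) \<le> K * (norm (y - x))\<^sup>2" for y
  proof -
    let ?n = "(norm (y - x))\<^sup>2"
    have a: "env x \<le> env y + \<rho>hat * ((y - phat y) \<bullet> (x - y)) + \<rho>hat / 2 * ?n"
      using env_upper_tangent[of x y] by (simp add: norm_minus_commute)
    have b: "(y - phat y) \<bullet> (x - y)
        = - ((x - phat x) \<bullet> (y - x)) + (phat y - phat x) \<bullet> (y - x) - ?n"
      by (simp add: power2_norm_eq_inner algebra_simps inner_commute)
    have c: "(phat y - phat x) \<bullet> (y - x) \<le> L * ?n"
    proof -
      have "norm (phat y - phat x) \<le> L * norm (y - x)"
        using phat_lipschitz[of y x] \<rho>hat unfolding L_def by (simp add: field_simps)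
      then have "norm (phat y - phat x) * norm (y - x) \<le> L * norm (y - x) * norm (y - x)"
        by (rule mult_right_mono) simp
      then show ?thesis
        using norm_cauchy_schwarz[of "phat y - phat x" "y - x"] by (simp add: power2_eq_square)
    qed
    have "- K * ?n \<le> env y - env x - \<rho>hat * ((x - phat x) \<bullet> (y - x))"
    proof -
      have "\<rho>hat * ((y - phat y) \<bullet> (x - y)) \<le> \<rho>hat * (- ((x - phat x) \<bullet> (y - x)) + L * ?n - ?n)"
        using b c rhohat_pos by (intro mult_left_mono) auto
      moreover have "0 \<le> \<rho>hat * ?n" using rhohat_pos by simp
      ultimately show ?thesis using a unfolding K_def by (simp add: algebra_simps)
    qed
    moreover have "env y - env x - \<rho>hat * ((x - phat x) \<bullet> (y - x)) \<le> K * ?n"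
    proof -
      have "\<rho>hat / 2 * ?n \<le> K * ?n"
        unfolding K_def using rhohat_pos \<open>0 < L\<close> by (intro mult_right_mono) (auto simp: algebra_simps)
      then show ?thesis using env_upper_tangent[of y x] by simp
    qed
    ultimately show ?thesis by (simp add: abs_le_iff inner_commute[of "y - x"])
  qed
  have "\<exists>d>0. \<forall>y. norm (y - x) < d \<longrightarrow>
      norm (env y - env x - (y - x) \<bullet> (\<rho>hat *\<^sub>R (x - phat x))) \<le> e * norm (y - x)"
    if "0 < e" for e
  proof (intro exI[of _ "e / K"] conjI allI impI)
    show "0 < e / K" using that \<open>0 < K\<close> by simp
    fix y assume "norm (y - x) < e / K"
    then have "K * norm (y - x) * norm (y - x) \<le> e * norm (y - x)"
      using \<open>0 < K\<close> by (intro mult_right_mono) (auto simp: field_simps)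
    then show "norm (env y - env x - (y - x) \<bullet> (\<rho>hat *\<^sub>R (x - phat x))) \<le> e * norm (y - x)"
      using key[of y] by (simp add: power2_eq_square mult.assoc)
  qed
  then show ?thesis
    unfolding gderiv_def has_derivative_at_alt using bounded_linear_inner_left by blast
qed

lemma gradient_env: "gradient env x = \<rho>hat *\<^sub>R (x - phat x)"
  by (rule gradient_eq[OF GDERIV_env])

lemma continuous_env: "continuous_on UNIV env"
  using GDERIV_env unfolding gderiv_def
  by (intro continuous_at_imp_continuous_on ballI has_derivative_continuous) blast

subsection \<open>One step of the method\<close>

lemma prox_r_subgradient:
  "0 < a \<Longrightarrow> subgradient r (prox a r u) ((1 / a) *\<^sub>R (u - prox a r u))"
  using prox_subgradient[OF r] edom_nonempty by blast

lemma prox_r_in_edom: "0 < a \<Longrightarrow> prox a r u \<in> edom r"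
  using prox_r_subgradient unfolding subgradient_def by blast

lemma continuous_prox_r: "0 < a \<Longrightarrow> continuous_on UNIV (prox a r)"
proof -
  assume "0 < a"
  have "1-lipschitz_on UNIV (prox a r)"
  proof (intro lipschitz_onI)
    fix u w
    show "dist (prox a r u) (prox a r w) \<le> 1 * dist u w"
      using resolvent_nonexpansive[OF \<open>0 < a\<close> prox_r_subgradient prox_r_subgradient] \<open>0 < a\<close>
      by (simp add: dist_norm)
  qed simp
  then show ?thesis by (rule lipschitz_on_continuous_on)
qed

text \<open>By \<open>phat_subgradient\<close>, the point \<open>phat x\<close> is the proximal point of
  \<open>w = phat x + a (\<rho>hat (x - phat x) - \<nabla>g (phat x))\<close> for the function \<open>a r\<close>. The noiseless step applies
  the same proximal map to \<open>x - a \<nabla>g x\<close>, and \<open>drift a x\<close> is the difference \<open>(x - a \<nabla>g x) - w\<close>.\<close>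

definition drift :: "real \<Rightarrow> 'a \<Rightarrow> 'a" where
  "drift a x = (1 - a * \<rho>hat) *\<^sub>R (x - phat x) - a *\<^sub>R (gradient g x - gradient g (phat x))"

text \<open>The triangle inequality gives the contraction factor
  \<open>(1 - a \<rho>hat) + a \<rho> = 1 - a (\<rho>hat - \<rho>)\<close>; it is here that \<open>a \<le> 1 / \<rho>hat\<close> is needed. The factor lies in
  \<open>[0, 1]\<close>, so one of its two occurrences in the square can be dropped.\<close>

lemma norm_drift:
  assumes a: "0 < a" "a \<le> 1 / \<rho>hat"
  shows "(norm (drift a x))\<^sup>2 \<le> (1 - a * (\<rho>hat - \<rho>)) * (norm (x - phat x))\<^sup>2"
proof -
  let ?s = "1 - a * (\<rho>hat - \<rho>)"
  have "a * \<rho>hat \<le> 1" using a rhohat_pos by (simp add: field_simps)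
  moreover have "0 \<le> a * \<rho>" "0 \<le> a * (\<rho>hat - \<rho>)" using a rho_nonneg \<rho>hat by auto
  ultimately have s: "0 \<le> ?s" "?s \<le> 1" by (auto simp: algebra_simps)
  have "norm (drift a x) \<le> norm ((1 - a * \<rho>hat) *\<^sub>R (x - phat x))
      + norm (a *\<^sub>R (gradient g x - gradient g (phat x)))"
    unfolding drift_def by (rule norm_triangle_ineq4)
  also have "\<dots> \<le> (1 - a * \<rho>hat) * norm (x - phat x) + a * (\<rho> * norm (x - phat x))"
    using \<open>a * \<rho>hat \<le> 1\<close> a gradient_lipschitz by (auto intro: add_mono mult_left_mono)
  also have "\<dots> = ?s * norm (x - phat x)" by (simp add: algebra_simps)
  finally have "(norm (drift a x))\<^sup>2 \<le> (?s * norm (x - phat x))\<^sup>2"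
    by (rule power_mono) simp
  also have "\<dots> = ?s * (?s * (norm (x - phat x))\<^sup>2)" by (simp add: power2_eq_square)
  also have "\<dots> \<le> ?s * (norm (x - phat x))\<^sup>2"
    using s by (intro mult_left_mono mult_left_le_one_le) auto
  finally show ?thesis .
qed

text \<open>The old proximal point \<open>phat x\<close> is a competitor for the envelope at the new iterate, and its
  distance to that iterate is controlled by nonexpansiveness of the proximal map of \<open>r\<close>.\<close>

lemma env_after_step:
  assumes a: "0 < a"
  shows "env (prox a r (x - a *\<^sub>R d)) \<le> env x - \<rho>hat / 2 * (norm (x - phat x))\<^sup>2
           + \<rho>hat / 2 * (norm (drift a x - a *\<^sub>R (d - gradient g x)))\<^sup>2"
proof -
  let ?p = "phat x" and ?x' = "prox a r (x - a *\<^sub>R d)"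
  define w where "w = ?p + a *\<^sub>R (\<rho>hat *\<^sub>R (x - ?p) - gradient g ?p)"
  have "subgradient r ?p ((1 / a) *\<^sub>R (w - ?p))"
    using phat_subgradient[of x] a unfolding w_def by simp
  then have "norm (?x' - ?p) \<le> norm ((x - a *\<^sub>R d) - w)"
    by (rule resolvent_nonexpansive[OF a prox_r_subgradient[OF a]])
  also have "(x - a *\<^sub>R d) - w = drift a x - a *\<^sub>R (d - gradient g x)"
    unfolding w_def drift_def by (simp add: algebra_simps)
  finally have "(norm (?p - ?x'))\<^sup>2 \<le> (norm (drift a x - a *\<^sub>R (d - gradient g x)))\<^sup>2"
    by (intro power_mono) (auto simp: norm_minus_commute)
  then have "\<rho>hat / 2 * (norm (?p - ?x'))\<^sup>2
      \<le> \<rho>hat / 2 * (norm (drift a x - a *\<^sub>R (d - gradient g x)))\<^sup>2"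
    using rhohat_pos by (intro mult_left_mono) auto
  then show ?thesis
    using env_le[OF phat_in_edom, of "?x'" x] env_eq[of x] by (simp add: norm_minus_commute)
qed

end

section \<open>Law and independence of the samples and the index\<close>

lemma prox_sgd_cong:
  assumes "\<And>s. s < t \<Longrightarrow> \<xi> s = \<xi>' s"
  shows "prox_sgd r G \<alpha> x0 \<xi> t = prox_sgd r G \<alpha> x0 \<xi>' t"
  using assms by (induction t) auto

text \<open>An event \<open>A\<close> that is independent of \<open>Y\<close> multiplies the law of \<open>Y\<close> by the constant \<open>P(A)\<close> when
  the measure is restricted to \<open>A\<close>. Comparing these two measures avoids random variables with a
  common codomain, which the index and the samples do not have.\<close>

lemma (in prob_space) nn_integral_indep_event:
  assumes Y: "Y \<in> measurable M N" and A: "A \<in> events"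
    and indep: "\<And>B. B \<in> sets N \<Longrightarrow>
      prob (A \<inter> (Y -` B \<inter> space M)) = prob A * prob (Y -` B \<inter> space M)"
    and f: "f \<in> borel_measurable N"
  shows "(\<integral>\<^sup>+\<omega>. indicator A \<omega> * f (Y \<omega>) \<partial>M) = emeasure M A * (\<integral>\<^sup>+y. f y \<partial>distr M N Y)"
proof -
  let ?D = "density M (indicator A)"
  have Y': "Y \<in> measurable ?D N" using Y by simp
  have "distr ?D N Y = scale_measure (emeasure M A) (distr M N Y)"
  proof (rule measure_eqI)
    fix B assume "B \<in> sets (distr ?D N Y)"
    then have B: "B \<in> sets N" by simp
    then have YB: "Y -` B \<inter> space M \<in> events" using Y by (rule measurable_sets[rotated])
    have "emeasure (distr ?D N Y) B = emeasure ?D (Y -` B \<inter> space M)"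
      using Y' B by (simp add: emeasure_distr)
    also have "\<dots> = (\<integral>\<^sup>+\<omega>. indicator A \<omega> * indicator (Y -` B \<inter> space M) \<omega> \<partial>M)"
      using A YB by (intro emeasure_density) auto
    also have "\<dots> = emeasure M (A \<inter> (Y -` B \<inter> space M))"
      using A YB by (simp add: indicator_inter_arith[symmetric])
    also have "\<dots> = emeasure M A * emeasure M (Y -` B \<inter> space M)"
      using indep[OF B] by (simp add: emeasure_eq_measure ennreal_mult)
    finally show "emeasure (distr ?D N Y) B = emeasure (scale_measure (emeasure M A) (distr M N Y)) B"
      using Y B by (simp add: emeasure_distr)
  qed simp
  then have "(\<integral>\<^sup>+y. f y \<partial>distr ?D N Y) = emeasure M A * (\<integral>\<^sup>+y. f y \<partial>distr M N Y)"
    using f by (simp add: nn_integral_scale_measure)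
  moreover have "(\<integral>\<^sup>+y. f y \<partial>distr ?D N Y) = (\<integral>\<^sup>+\<omega>. indicator A \<omega> * f (Y \<omega>) \<partial>M)"
    using Y Y' A f by (simp add: nn_integral_distr nn_integral_density)
  ultimately show ?thesis by simp
qed

lemma sgd_samples_distr:
  assumes "sgd_randomness M P T \<alpha> \<xi> tstar"
  shows "(\<lambda>\<omega>. \<lambda>t\<in>{..T}. \<xi> t \<omega>) \<in> measurable M (Pi\<^sub>M {..T} (\<lambda>_. P))"
    and "distr M (Pi\<^sub>M {..T} (\<lambda>_. P)) (\<lambda>\<omega>. \<lambda>t\<in>{..T}. \<xi> t \<omega>) = Pi\<^sub>M {..T} (\<lambda>_. P)"
proof -
  interpret prob_space M using assms unfolding sgd_randomness_def by simp
  have indep: "indep_vars (\<lambda>_. P) \<xi> {..T}" and law: "\<And>t. t \<le> T \<Longrightarrow> distr M P (\<xi> t) = P"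
    using assms unfolding sgd_randomness_def by auto
  have rv: "\<xi> t \<in> measurable M P" if "t \<in> {..T}" for t
    using indep that unfolding indep_vars_def2 by blast
  then show "(\<lambda>\<omega>. \<lambda>t\<in>{..T}. \<xi> t \<omega>) \<in> measurable M (Pi\<^sub>M {..T} (\<lambda>_. P))"
    by (rule measurable_restrict)
  have "distr M (Pi\<^sub>M {..T} (\<lambda>_. P)) (\<lambda>\<omega>. \<lambda>t\<in>{..T}. \<xi> t \<omega>) = Pi\<^sub>M {..T} (\<lambda>t. distr M P (\<xi> t))"
    using indep indep_vars_iff_distr_eq_PiM'[where I = "{..T}" and X = \<xi> and M' = "\<lambda>_. P"] rv by auto
  also have "\<dots> = Pi\<^sub>M {..T} (\<lambda>_. P)" using law by (intro PiM_cong) auto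
  finally show "distr M (Pi\<^sub>M {..T} (\<lambda>_. P)) (\<lambda>\<omega>. \<lambda>t\<in>{..T}. \<xi> t \<omega>) = Pi\<^sub>M {..T} (\<lambda>_. P)" .
qed

lemma sgd_index_indep:
  assumes rnd: "sgd_randomness M P T \<alpha> \<xi> tstar" and t: "t \<le> T"
    and F: "F \<in> borel_measurable (Pi\<^sub>M {..T} (\<lambda>_. P))"
  shows "{\<omega> \<in> space M. tstar \<omega> = t} \<in> sets M"
    and "(\<integral>\<^sup>+\<omega>. indicator {\<omega> \<in> space M. tstar \<omega> = t} \<omega> * F (\<lambda>t\<in>{..T}. \<xi> t \<omega>) \<partial>M)
           = ennreal (\<alpha> t / (\<Sum>s\<le>T. \<alpha> s)) * (\<integral>\<^sup>+z. F z \<partial>Pi\<^sub>M {..T} (\<lambda>_. P))"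
proof -
  interpret prob_space M using rnd unfolding sgd_randomness_def by simp
  let ?Y = "\<lambda>\<omega>. \<lambda>t\<in>{..T}. \<xi> t \<omega>" and ?N = "Pi\<^sub>M {..T} (\<lambda>_. P)"
  let ?A = "{\<omega> \<in> space M. tstar \<omega> = t}"
  have tstar: "tstar \<in> measurable M (count_space {..T})"
    and pA: "prob ?A = \<alpha> t / (\<Sum>s\<le>T. \<alpha> s)"
    and indep: "indep_set (sets (vimage_algebra (space M) tstar (count_space {..T})))
       (sets (vimage_algebra (space M) ?Y ?N))"
    using rnd t unfolding sgd_randomness_def by auto
  have A: "?A = tstar -` {t} \<inter> space M" by auto
  show ev: "?A \<in> events" unfolding A using tstar t by (intro measurable_sets) auto
  have "?A \<in> sets (vimage_algebra (space M) tstar (count_space {..T}))"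
    unfolding A using t by (intro in_vimage_algebra) auto
  then have "prob (?A \<inter> (?Y -` B \<inter> space M)) = prob ?A * prob (?Y -` B \<inter> space M)"
    if "B \<in> sets ?N" for B
    using that by (intro indep_setD[OF indep] in_vimage_algebra)
  then have "(\<integral>\<^sup>+\<omega>. indicator ?A \<omega> * F (?Y \<omega>) \<partial>M) = emeasure M ?A * (\<integral>\<^sup>+z. F z \<partial>distr M ?N ?Y)"
    by (rule nn_integral_indep_event[OF sgd_samples_distr(1)[OF rnd] ev _ F])
  then show "(\<integral>\<^sup>+\<omega>. indicator ?A \<omega> * F (?Y \<omega>) \<partial>M)
      = ennreal (\<alpha> t / (\<Sum>s\<le>T. \<alpha> s)) * (\<integral>\<^sup>+z. F z \<partial>?N)"
    unfolding sgd_samples_distr(2)[OF rnd] by (simp add: emeasure_eq_measure pA)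
qed

section \<open>Expected progress of the method\<close>

locale stochastic_composite_problem = composite_problem r g \<rho> \<rho>hat \<phi>
  for r :: "'a::euclidean_space \<Rightarrow> ereal" and g \<rho> \<rho>hat \<phi> +
  fixes P :: "'w measure" and U :: "'a set" and G :: "'a \<Rightarrow> 'w \<Rightarrow> 'a" and \<sigma> :: real
  assumes P: "prob_space P" and U: "edom r \<subseteq> U"
    and unbiased: "unbiased_oracle P U G g" and variance: "variance_bounded P (edom r) G g \<sigma>"
begin

definition gap :: "'a \<Rightarrow> real" where
  "gap x = env x - real_of_ereal (min_value \<phi>)"

lemma gap_nonneg: "0 \<le> gap x"
  unfolding gap_def using min_value_le_env by simp

text \<open>A step of length \<open>a\<close> lowers \<open>gap\<close> in expectation by at least this amount, apart from the noise.\<close>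

definition decrease :: "real \<Rightarrow> 'a \<Rightarrow> real" where
  "decrease a x = a * (\<rho>hat - \<rho>) / (2 * \<rho>hat) * (norm (gradient env x))\<^sup>2"

lemma decrease_nonneg: "0 \<le> a \<Longrightarrow> 0 \<le> decrease a x"
  unfolding decrease_def using \<rho>hat rhohat_pos by simp

lemma decrease_eq: "decrease a x = \<rho>hat / 2 * (a * (\<rho>hat - \<rho>) * (norm (x - phat x))\<^sup>2)"
proof -
  have "(norm (\<rho>hat *\<^sub>R (x - phat x)))\<^sup>2 = \<rho>hat\<^sup>2 * (norm (x - phat x))\<^sup>2"
    by (simp add: power_mult_distrib)
  then show ?thesis
    unfolding decrease_def gradient_env using rhohat_pos by (simp add: field_simps power2_eq_square)
qed

text \<open>Expand the square in \<open>env_after_step\<close>. The cross term between the drift and the noise has mean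
  zero because the estimate \<open>G\<close> is unbiased, the squared noise contributes at most \<open>a\<^sup>2 \<sigma>\<^sup>2\<close>, and
  \<open>norm_drift\<close> produces the decrease.\<close>

lemma expected_step:
  assumes x: "x \<in> edom r" and a: "0 < a" "a \<le> 1 / \<rho>hat"
  shows "(\<integral>\<^sup>+w. ennreal (gap (prox a r (x - a *\<^sub>R G x w))) \<partial>P) + ennreal (decrease a x)
           \<le> ennreal (gap x) + ennreal (\<rho>hat * \<sigma>\<^sup>2 / 2 * a\<^sup>2)"
proof -
  interpret P: prob_space P by (rule P)
  let ?u = "drift a x"
  define \<delta> where "\<delta> w = G x w - gradient g x" for w
  define D where "D = (norm (x - phat x))\<^sup>2"
  define V where "V = (\<integral>w. (norm (\<delta> w))\<^sup>2 \<partial>P)"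
  have "has_bochner_integral P (G x) (gradient g x)"
    using unbiased x U unfolding unbiased_oracle_def by auto
  then have "has_bochner_integral P \<delta> (gradient g x - gradient g x)"
    unfolding \<delta>_def by (intro has_bochner_integral_diff) (auto simp: has_bochner_integral_iff P.prob_space)
  then have mean: "has_bochner_integral P (\<lambda>w. ?u \<bullet> \<delta> w) 0"
    using has_bochner_integral_inner_right[of ?u P \<delta> 0] by simp
  have V: "has_bochner_integral P (\<lambda>w. (norm (\<delta> w))\<^sup>2) V" "V \<le> \<sigma>\<^sup>2"
    using variance x unfolding variance_bounded_def V_def \<delta>_def
    by (auto intro: has_bochner_integral_integrable)
  have const: "has_bochner_integral P (\<lambda>_. c) c" for c :: real
    by (simp add: has_bochner_integral_iff P.prob_space)
  \<comment> \<open>\<open>h\<close> is the upper bound of \<open>env_after_step\<close> with its square expanded.\<close>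
  define h where "h w = gap x - \<rho>hat / 2 * D
      + \<rho>hat / 2 * ((norm ?u)\<^sup>2 - 2 * a * (?u \<bullet> \<delta> w) + a\<^sup>2 * (norm (\<delta> w))\<^sup>2)" for w
  have "has_bochner_integral P h (gap x - \<rho>hat / 2 * D + \<rho>hat / 2 * ((norm ?u)\<^sup>2 - 2 * a * 0 + a\<^sup>2 * V))"
    unfolding h_def
    by (intro has_bochner_integral_add has_bochner_integral_diff has_bochner_integral_mult_right
        const mean V)
  then have h: "integrable P h"
      "(\<integral>w. h w \<partial>P) = gap x - \<rho>hat / 2 * D + \<rho>hat / 2 * ((norm ?u)\<^sup>2 + a\<^sup>2 * V)"
    by (auto simp: has_bochner_integral_iff)
  have step: "gap (prox a r (x - a *\<^sub>R G x w)) \<le> h w" for w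
  proof -
    have "(norm (?u - a *\<^sub>R \<delta> w))\<^sup>2 = (norm ?u)\<^sup>2 - 2 * a * (?u \<bullet> \<delta> w) + a\<^sup>2 * (norm (\<delta> w))\<^sup>2"
      by (simp add: power2_norm_eq_inner inner_commute algebra_simps) (simp add: power2_eq_square)
    then show ?thesis
      using env_after_step[OF a(1), of x "G x w"] unfolding h_def gap_def D_def \<delta>_def by simp
  qed
  have h_nonneg: "0 \<le> h w" for w
    using gap_nonneg step order_trans by blast
  have "(\<integral>w. h w \<partial>P) + decrease a x \<le> gap x + \<rho>hat * \<sigma>\<^sup>2 / 2 * a\<^sup>2"
  proof -
    have "(norm ?u)\<^sup>2 + a\<^sup>2 * V \<le> (1 - a * (\<rho>hat - \<rho>)) * D + a\<^sup>2 * \<sigma>\<^sup>2"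
      unfolding D_def using V(2) by (intro add_mono norm_drift a mult_left_mono) auto
    then have "\<rho>hat / 2 * ((norm ?u)\<^sup>2 + a\<^sup>2 * V) \<le> \<rho>hat / 2 * ((1 - a * (\<rho>hat - \<rho>)) * D + a\<^sup>2 * \<sigma>\<^sup>2)"
      using rhohat_pos by (intro mult_left_mono) auto
    then show ?thesis
      unfolding h(2) decrease_eq D_def[symmetric] by (simp add: algebra_simps)
  qed
  then have "ennreal (\<integral>w. h w \<partial>P) + ennreal (decrease a x)
      \<le> ennreal (gap x) + ennreal (\<rho>hat * \<sigma>\<^sup>2 / 2 * a\<^sup>2)"
    using rhohat_pos a h_nonneg decrease_nonneg[of a x] gap_nonneg[of x]
    by (simp add: ennreal_plus[symmetric] ennreal_leI del: ennreal_plus)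
  moreover have "(\<integral>\<^sup>+w. ennreal (gap (prox a r (x - a *\<^sub>R G x w))) \<partial>P) \<le> ennreal (\<integral>w. h w \<partial>P)"
  proof -
    have "(\<integral>\<^sup>+w. ennreal (gap (prox a r (x - a *\<^sub>R G x w))) \<partial>P) \<le> (\<integral>\<^sup>+w. ennreal (h w) \<partial>P)"
      using step by (intro nn_integral_mono ennreal_leI) auto
    also have "\<dots> = ennreal (\<integral>w. h w \<partial>P)"
      using h(1) h_nonneg by (intro nn_integral_eq_integral) auto
    finally show ?thesis .
  qed
  ultimately show ?thesis
    by (meson add_right_mono order_trans)
qed

lemma measurable_gap: "gap \<in> borel_measurable borel"
  and measurable_decrease: "decrease a \<in> borel_measurable borel"
  and measurable_gradient_env: "gradient env \<in> borel_measurable borel"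
proof -
  have [measurable]: "env \<in> borel_measurable borel" "phat \<in> borel_measurable borel"
    using continuous_env continuous_phat by (auto intro: borel_measurable_continuous_onI)
  show "gap \<in> borel_measurable borel" unfolding gap_def[abs_def] by measurable
  have "gradient env = (\<lambda>x. \<rho>hat *\<^sub>R (x - phat x))" using gradient_env by auto
  also have "\<dots> \<in> borel_measurable borel" by measurable
  finally show [measurable]: "gradient env \<in> borel_measurable borel" .
  show "decrease a \<in> borel_measurable borel" unfolding decrease_def[abs_def] by measurable
qed

lemma sgd_in_edom:
  assumes "x0 \<in> edom r" "\<And>s. s < t \<Longrightarrow> 0 < \<alpha> s"
  shows "prox_sgd r G \<alpha> x0 z t \<in> edom r"
  using assms prox_r_in_edom by (cases t) auto

text \<open>Stated for every index set that contains the samples used so far: the iterate is integrated over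
  \<open>{..<t}\<close> and over \<open>{..T}\<close>, and the inductive step needs it on a product that also carries the
  next sample. Since \<open>G\<close> is only measurable on \<open>U \<times> \<Omega>\<close>, it matters that the iterates stay in the
  domain of \<open>r\<close>.\<close>

lemma sgd_measurable:
  assumes x0: "x0 \<in> edom r" and pos: "\<And>s. s < t \<Longrightarrow> 0 < \<alpha> s" and J: "{..<t} \<subseteq> J"
  shows "(\<lambda>z. prox_sgd r G \<alpha> x0 z t) \<in> borel_measurable (Pi\<^sub>M J (\<lambda>_. P))"
  using pos J
proof (induction t)
  case (Suc t)
  let ?X = "\<lambda>z. prox_sgd r G \<alpha> x0 z t"
  have X: "?X \<in> borel_measurable (Pi\<^sub>M J (\<lambda>_. P))"
    by (rule Suc.IH) (use Suc.prems in auto)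
  then have "?X \<in> measurable (Pi\<^sub>M J (\<lambda>_. P)) (restrict_space borel U)"
    using sgd_in_edom[OF x0, of t \<alpha>] Suc.prems(1) U by (intro measurable_restrict_space2) auto
  moreover have "(\<lambda>z. z t) \<in> measurable (Pi\<^sub>M J (\<lambda>_. P)) P"
    using Suc.prems(2) by (intro measurable_component_singleton) auto
  ultimately have "(\<lambda>z. (?X z, z t)) \<in> measurable (Pi\<^sub>M J (\<lambda>_. P)) (restrict_space borel U \<Otimes>\<^sub>M P)"
    by (rule measurable_Pair)
  then have "(\<lambda>z. (case (?X z, z t) of (x, w) \<Rightarrow> G x w)) \<in> borel_measurable (Pi\<^sub>M J (\<lambda>_. P))"
    using unbiased unfolding unbiased_oracle_def by (elim conjE) (rule measurable_compose)
  then have "(\<lambda>z. G (?X z) (z t)) \<in> borel_measurable (Pi\<^sub>M J (\<lambda>_. P))" by simp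
  with X have "(\<lambda>z. ?X z - \<alpha> t *\<^sub>R G (?X z) (z t)) \<in> borel_measurable (Pi\<^sub>M J (\<lambda>_. P))"
    by measurable
  moreover have "prox (\<alpha> t) r \<in> borel_measurable borel"
    using Suc.prems(1) by (intro borel_measurable_continuous_onI continuous_prox_r) auto
  ultimately show ?case by (simp add: measurable_compose)
qed simp

text \<open>The iterate \<open>x\<^sub>t\<close> depends on the samples in \<open>{..<t}\<close> only. By Fubini, the integral over
  \<open>{..<Suc n}\<close> is an iterated one whose inner integral, over the fresh sample \<open>n\<close> with \<open>x\<^sub>n\<close> held fixed,
  is bounded by \<open>expected_step\<close>. Expectations along the iterates are nonnegative integrals; that
  they are finite is part of the conclusion.\<close>

lemma telescoped_decrease:
  assumes x0: "x0 \<in> edom r" and \<alpha>: "\<And>s. s < n \<Longrightarrow> 0 < \<alpha> s \<and> \<alpha> s \<le> 1 / \<rho>hat"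
  shows "(\<integral>\<^sup>+z. ennreal (gap (prox_sgd r G \<alpha> x0 z n)) \<partial>Pi\<^sub>M {..<n} (\<lambda>_. P))
           + (\<Sum>t<n. \<integral>\<^sup>+z. ennreal (decrease (\<alpha> t) (prox_sgd r G \<alpha> x0 z t)) \<partial>Pi\<^sub>M {..<t} (\<lambda>_. P))
         \<le> ennreal (gap x0) + (\<Sum>t<n. ennreal (\<rho>hat * \<sigma>\<^sup>2 / 2 * (\<alpha> t)\<^sup>2))"
  using \<alpha>
proof (induction n)
  case 0
  interpret prob_space "Pi\<^sub>M {} (\<lambda>_. P)" by (intro prob_space_PiM P)
  show ?case by (simp add: emeasure_space_1)
next
  case (Suc n)
  interpret P: prob_space P by (rule P)
  interpret product_sigma_finite "\<lambda>_. P" by unfold_locales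
  interpret N: prob_space "Pi\<^sub>M {..<n} (\<lambda>_. P)" by (intro prob_space_PiM P)
  let ?X = "\<lambda>t z. prox_sgd r G \<alpha> x0 z t"
  let ?N = "Pi\<^sub>M {..<n} (\<lambda>_. P)"
  let ?K = "ennreal (\<rho>hat * \<sigma>\<^sup>2 / 2 * (\<alpha> n)\<^sup>2)"
  let ?next = "\<lambda>z w. ennreal (gap (prox (\<alpha> n) r (?X n z - \<alpha> n *\<^sub>R G (?X n z) w)))"
  have n: "0 < \<alpha> n" "\<alpha> n \<le> 1 / \<rho>hat" using Suc.prems by auto
  have X': "?X (Suc n) \<in> borel_measurable (Pi\<^sub>M (insert n {..<n}) (\<lambda>_. P))"
    by (rule sgd_measurable[OF x0]) (use Suc.prems in auto)
  have Xgap[measurable]: "(\<lambda>z. ennreal (gap (?X (Suc n) z))) \<in> borel_measurable (Pi\<^sub>M (insert n {..<n}) (\<lambda>_. P))"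
    by (rule measurable_compose[OF measurable_compose[OF X' measurable_gap] measurable_ennreal])
  have X: "?X n \<in> borel_measurable ?N"
    by (rule sgd_measurable[OF x0]) (use Suc.prems in auto)
  have [measurable]: "(\<lambda>z. ennreal (gap (?X n z))) \<in> borel_measurable ?N"
      "(\<lambda>z. ennreal (decrease (\<alpha> n) (?X n z))) \<in> borel_measurable ?N"
    by (rule measurable_compose[OF measurable_compose[OF X measurable_gap] measurable_ennreal]
        measurable_compose[OF measurable_compose[OF X measurable_decrease] measurable_ennreal])+
  have upd: "ennreal (gap (?X (Suc n) (z(n := w)))) = ?next z w" for z w
  proof -
    have "?X n (z(n := w)) = ?X n z" by (rule prox_sgd_cong) auto
    then show ?thesis by simp
  qed
  have "(\<lambda>p. ennreal (gap (?X (Suc n) ((fst p)(n := snd p))))) \<in> borel_measurable (?N \<Otimes>\<^sub>M P)"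
    by measurable
  then have meas: "(\<lambda>z. \<integral>\<^sup>+w. ?next z w \<partial>P) \<in> borel_measurable ?N"
    unfolding upd by (intro P.borel_measurable_nn_integral) (simp add: case_prod_unfold)
  have "(\<integral>\<^sup>+z. ennreal (gap (?X (Suc n) z)) \<partial>Pi\<^sub>M {..<Suc n} (\<lambda>_. P))
      + (\<integral>\<^sup>+z. ennreal (decrease (\<alpha> n) (?X n z)) \<partial>?N)
      = (\<integral>\<^sup>+z. (\<integral>\<^sup>+w. ?next z w \<partial>P) \<partial>?N) + (\<integral>\<^sup>+z. ennreal (decrease (\<alpha> n) (?X n z)) \<partial>?N)"
    unfolding lessThan_Suc by (subst product_nn_integral_insert[OF _ _ Xgap]) (simp_all only: upd, auto)
  also have "\<dots> = (\<integral>\<^sup>+z. (\<integral>\<^sup>+w. ?next z w \<partial>P) + ennreal (decrease (\<alpha> n) (?X n z)) \<partial>?N)"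
    using meas by (intro nn_integral_add[symmetric]) auto
  also have "\<dots> \<le> (\<integral>\<^sup>+z. ennreal (gap (?X n z)) + ?K \<partial>?N)"
    using Suc.prems by (intro nn_integral_mono expected_step n sgd_in_edom x0) auto
  also have "\<dots> = (\<integral>\<^sup>+z. ennreal (gap (?X n z)) \<partial>?N) + ?K"
    by (subst nn_integral_add) (auto simp: N.emeasure_space_1)
  finally have step: "(\<integral>\<^sup>+z. ennreal (gap (?X (Suc n) z)) \<partial>Pi\<^sub>M {..<Suc n} (\<lambda>_. P))
      + (\<integral>\<^sup>+z. ennreal (decrease (\<alpha> n) (?X n z)) \<partial>?N)
      \<le> (\<integral>\<^sup>+z. ennreal (gap (?X n z)) \<partial>?N) + ?K" .
  let ?S = "\<Sum>t<n. \<integral>\<^sup>+z. ennreal (decrease (\<alpha> t) (?X t z)) \<partial>Pi\<^sub>M {..<t} (\<lambda>_. P)"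
  have "(\<integral>\<^sup>+z. ennreal (gap (?X (Suc n) z)) \<partial>Pi\<^sub>M {..<Suc n} (\<lambda>_. P))
      + (?S + (\<integral>\<^sup>+z. ennreal (decrease (\<alpha> n) (?X n z)) \<partial>?N))
      \<le> ((\<integral>\<^sup>+z. ennreal (gap (?X n z)) \<partial>?N) + ?K) + ?S"
    using add_right_mono[OF step, of ?S] by (simp only: ac_simps)
  also have "\<dots> \<le> (ennreal (gap x0) + (\<Sum>t<n. ennreal (\<rho>hat * \<sigma>\<^sup>2 / 2 * (\<alpha> t)\<^sup>2))) + ?K"
    using add_right_mono[OF Suc.IH, of ?K] Suc.prems by (simp add: ac_simps)
  finally show ?case by (simp only: sum.lessThan_Suc add.assoc)
qed

text \<open>Splitting along the value of the index \<open>tstar\<close>, which is independent of the samples, turns the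
  expectation into the average of the expected squared gradients with weights proportional to the
  stepsizes. The decreases in \<open>telescoped_decrease\<close> carry the same weights, so that up to the factor
  \<open>k\<close> the expectation is their sum.\<close>

lemma expected_gradient_bound:
  fixes M :: "'m measure"
  assumes x0: "x0 \<in> edom r" and \<alpha>: "\<And>t. t \<le> T \<Longrightarrow> 0 < \<alpha> t \<and> \<alpha> t \<le> 1 / \<rho>hat"
    and rnd: "sgd_randomness M P T \<alpha> \<xi> tstar"
  defines "f \<equiv> (\<lambda>\<omega>. (norm (gradient env (prox_sgd r G \<alpha> x0 (\<lambda>t. \<xi> t \<omega>) (tstar \<omega>))))\<^sup>2)"
  shows "integrable M f"
    and "(\<integral>\<omega>. f \<omega> \<partial>M) \<le> 2 * \<rho>hat / (\<rho>hat - \<rho>) *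
      ((gap x0 + \<rho>hat * \<sigma>\<^sup>2 / 2 * (\<Sum>t\<le>T. (\<alpha> t)\<^sup>2)) / (\<Sum>t\<le>T. \<alpha> t))"
proof -
  interpret M: prob_space M using rnd unfolding sgd_randomness_def by simp
  interpret P: product_prob_space "\<lambda>_. P" UNIV by (intro product_prob_spaceI P)
  let ?PT = "Pi\<^sub>M {..T} (\<lambda>_. P)" and ?Y = "\<lambda>\<omega>. \<lambda>t\<in>{..T}. \<xi> t \<omega>"
  let ?X = "\<lambda>t z. prox_sgd r G \<alpha> x0 z t"
  let ?A = "\<lambda>t. {\<omega> \<in> space M. tstar \<omega> = t}"
  define S where "S = (\<Sum>t\<le>T. \<alpha> t)"
  define k where "k = (\<rho>hat - \<rho>) / (2 * \<rho>hat) * S"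
  define B where "B = gap x0 + \<rho>hat * \<sigma>\<^sup>2 / 2 * (\<Sum>t\<le>T. (\<alpha> t)\<^sup>2)"
  define q where "q x = (norm (gradient env x))\<^sup>2" for x
  have "0 < S" unfolding S_def using \<alpha> by (intro sum_pos) auto
  then have "0 < k" unfolding k_def using \<rho>hat rhohat_pos by simp
  have "0 \<le> B"
    unfolding B_def using gap_nonneg rhohat_pos by (intro add_nonneg_nonneg mult_nonneg_nonneg sum_nonneg) auto
  have [measurable]: "q \<in> borel_measurable borel"
    using measurable_gradient_env unfolding q_def[abs_def] by measurable
  have Xm: "?X t \<in> borel_measurable (Pi\<^sub>M J (\<lambda>_. P))" if "t \<le> T" "{..<t} \<subseteq> J" for t J
    by (rule sgd_measurable[OF x0]) (use that \<alpha> in auto)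
  have [measurable]: "(\<lambda>z. q (?X t z)) \<in> borel_measurable ?PT" if "t \<le> T" for t
    by (rule measurable_compose[OF Xm[OF that] \<open>q \<in> _\<close>]) (use that in auto)
  have Y[measurable]: "?Y \<in> measurable M ?PT" by (rule sgd_samples_distr(1)[OF rnd])
  have A[measurable]: "?A t \<in> sets M" if "t \<le> T" for t
    using sgd_index_indep(1)[OF rnd that, of "\<lambda>_. 0"] by simp
  have f_eq: "f \<omega> = (\<Sum>t\<le>T. indicator (?A t) \<omega> * q (?X t (?Y \<omega>)))" if \<omega>: "\<omega> \<in> space M" for \<omega>
  proof -
    have "tstar \<omega> \<in> {..T}"
      using rnd \<omega> unfolding sgd_randomness_def by (auto dest: measurable_space)
    moreover have "?X t (?Y \<omega>) = ?X t (\<lambda>t. \<xi> t \<omega>)" if "t \<le> T" for t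
      using that by (intro prox_sgd_cong) auto
    moreover have "(\<Sum>t\<le>T. indicator (?A t) \<omega> * q (?X t (?Y \<omega>)))
        = (\<Sum>t\<le>T. if tstar \<omega> = t then q (?X t (?Y \<omega>)) else 0)"
      using \<omega> by (intro sum.cong) (auto simp: indicator_def)
    ultimately show ?thesis unfolding f_def q_def by simp
  qed
  have f_meas: "f \<in> borel_measurable M"
    by (subst measurable_cong[OF f_eq]) measurable
  define b where "b t = (\<integral>\<^sup>+z. ennreal (q (?X t z)) \<partial>Pi\<^sub>M {..<t} (\<lambda>_. P))" for t
  have marginal: "(\<integral>\<^sup>+z. ennreal (q (?X t z)) \<partial>?PT) = b t" if "t \<le> T" for t
  proof -
    have sub: "{..<t} \<subseteq> {..T}" using that by auto
    have "b t = (\<integral>\<^sup>+z. ennreal (q (?X t z)) \<partial>distr ?PT (Pi\<^sub>M {..<t} (\<lambda>_. P)) (\<lambda>z. restrict z {..<t}))"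
      unfolding b_def using P.distr_restrict[OF sub] by simp
    also have "\<dots> = (\<integral>\<^sup>+z. ennreal (q (?X t (restrict z {..<t}))) \<partial>?PT)"
      using sub Xm[OF that, of "{..<t}"]
      by (intro nn_integral_distr measurable_restrict_subset) auto
    also have "\<dots> = (\<integral>\<^sup>+z. ennreal (q (?X t z)) \<partial>?PT)"
    proof -
      have "?X t (restrict z {..<t}) = ?X t z" for z by (rule prox_sgd_cong) auto
      then show ?thesis by simp
    qed
    finally show ?thesis by simp
  qed
  have Ef: "(\<integral>\<^sup>+\<omega>. ennreal (f \<omega>) \<partial>M) = (\<Sum>t\<le>T. ennreal (\<alpha> t / S) * b t)"
  proof -
    have "ennreal (f \<omega>) = (\<Sum>t\<le>T. indicator (?A t) \<omega> * ennreal (q (?X t (?Y \<omega>))))"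
      if "\<omega> \<in> space M" for \<omega>
      unfolding f_eq[OF that]
      by (subst sum_ennreal[symmetric])
         (auto simp: q_def ennreal_mult ennreal_indicator intro!: sum.cong)
    then have "(\<integral>\<^sup>+\<omega>. ennreal (f \<omega>) \<partial>M)
        = (\<integral>\<^sup>+\<omega>. (\<Sum>t\<le>T. indicator (?A t) \<omega> * ennreal (q (?X t (?Y \<omega>)))) \<partial>M)"
      by (rule nn_integral_cong)
    also have "\<dots> = (\<Sum>t\<le>T. \<integral>\<^sup>+\<omega>. indicator (?A t) \<omega> * ennreal (q (?X t (?Y \<omega>))) \<partial>M)"
      by (rule nn_integral_sum) measurable
    also have "\<dots> = (\<Sum>t\<le>T. ennreal (\<alpha> t / S) * b t)"
      unfolding S_def
      by (intro sum.cong refl) (subst sgd_index_indep(2)[OF rnd], auto simp: marginal)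
    finally show ?thesis .
  qed
  have "ennreal k * (\<integral>\<^sup>+\<omega>. ennreal (f \<omega>) \<partial>M)
      = (\<Sum>t<Suc T. \<integral>\<^sup>+z. ennreal (decrease (\<alpha> t) (?X t z)) \<partial>Pi\<^sub>M {..<t} (\<lambda>_. P))"
  proof -
    have "ennreal k * (ennreal (\<alpha> t / S) * b t)
        = (\<integral>\<^sup>+z. ennreal (decrease (\<alpha> t) (?X t z)) \<partial>Pi\<^sub>M {..<t} (\<lambda>_. P))" if t: "t \<le> T" for t
    proof -
      let ?c = "\<alpha> t * (\<rho>hat - \<rho>) / (2 * \<rho>hat)"
      have "0 \<le> ?c" using \<alpha>[OF t] \<rho>hat rhohat_pos by simp
      have "(\<integral>\<^sup>+z. ennreal (decrease (\<alpha> t) (?X t z)) \<partial>Pi\<^sub>M {..<t} (\<lambda>_. P))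
          = (\<integral>\<^sup>+z. ennreal ?c * ennreal (q (?X t z)) \<partial>Pi\<^sub>M {..<t} (\<lambda>_. P))"
        unfolding decrease_def q_def using \<open>0 \<le> ?c\<close> by (subst ennreal_mult) auto
      also have "\<dots> = ennreal ?c * b t"
        unfolding b_def using Xm[OF t, of "{..<t}"] by (intro nn_integral_cmult) auto
      also have "ennreal ?c = ennreal k * ennreal (\<alpha> t / S)"
      proof -
        have "?c = k * (\<alpha> t / S)" unfolding k_def using \<open>0 < S\<close> by simp
        then show ?thesis using \<open>0 < S\<close> \<open>0 < k\<close> \<alpha>[OF t] by (simp add: ennreal_mult[symmetric])
      qed
      finally show ?thesis by (simp add: mult.assoc)
    qed
    then show ?thesis unfolding Ef sum_distrib_left lessThan_Suc_atMost by (intro sum.cong) auto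
  qed
  also have "\<dots> \<le> ennreal (gap x0) + (\<Sum>t<Suc T. ennreal (\<rho>hat * \<sigma>\<^sup>2 / 2 * (\<alpha> t)\<^sup>2))"
    using \<alpha> by (intro order_trans[OF _ telescoped_decrease[OF x0]]) auto
  also have "\<dots> = ennreal B"
    unfolding B_def sum_distrib_left lessThan_Suc_atMost
    using gap_nonneg rhohat_pos by (subst ennreal_plus) (auto intro: sum_nonneg simp: sum_ennreal)
  finally have le: "ennreal k * (\<integral>\<^sup>+\<omega>. ennreal (f \<omega>) \<partial>M) \<le> ennreal B" .
  have Ef_le: "(\<integral>\<^sup>+\<omega>. ennreal (f \<omega>) \<partial>M) \<le> ennreal (B / k)"
  proof -
    have "(\<integral>\<^sup>+\<omega>. ennreal (f \<omega>) \<partial>M) = ennreal (1 / k) * (ennreal k * (\<integral>\<^sup>+\<omega>. ennreal (f \<omega>) \<partial>M))"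
      using \<open>0 < k\<close> by (simp add: mult.assoc[symmetric] ennreal_mult[symmetric])
    also have "\<dots> \<le> ennreal (1 / k) * ennreal B" using le by (rule mult_left_mono) simp
    also have "\<dots> = ennreal (B / k)"
      using \<open>0 < k\<close> \<open>0 \<le> B\<close> by (simp add: ennreal_mult[symmetric])
    finally show ?thesis .
  qed
  have f_nonneg: "0 \<le> f \<omega>" for \<omega> unfolding f_def by simp
  show int: "integrable M f"
    using f_meas f_nonneg le_less_trans[OF Ef_le] by (intro integrableI_nonneg) auto
  have "ennreal (\<integral>\<omega>. f \<omega> \<partial>M) \<le> ennreal (B / k)"
    using Ef_le nn_integral_eq_integral[OF int] f_nonneg by simp
  then have "(\<integral>\<omega>. f \<omega> \<partial>M) \<le> B / k"
    using \<open>0 < k\<close> \<open>0 \<le> B\<close> by (subst (asm) ennreal_le_iff) auto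
  also have "B / k = 2 * \<rho>hat / (\<rho>hat - \<rho>) * (B / S)"
    unfolding k_def using \<open>0 < S\<close> \<rho>hat rhohat_pos by (simp add: field_simps)
  finally show "(\<integral>\<omega>. f \<omega> \<partial>M) \<le> 2 * \<rho>hat / (\<rho>hat - \<rho>) *
      ((gap x0 + \<rho>hat * \<sigma>\<^sup>2 / 2 * (\<Sum>t\<le>T. (\<alpha> t)\<^sup>2)) / (\<Sum>t\<le>T. \<alpha> t))"
    unfolding B_def S_def .
qed

end

section \<open>Complexity of the proximal stochastic gradient method\<close>

text \<open>The second part is the first one with \<open>\<rho>hat = 2 \<rho>\<close>: a constant stepsize \<open>\<gamma> / \<surd>(T + 1)\<close> has
  sum \<open>\<gamma> \<surd>(T + 1)\<close> and sum of squares \<open>\<gamma>\<^sup>2\<close>.\<close>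

theorem corollary2p8:
  fixes r :: "real ^ 'd \<Rightarrow> ereal"
    and g :: "real ^ 'd \<Rightarrow> real"
    and \<phi> :: "real ^ 'd \<Rightarrow> ereal"
    and P :: "'w measure"
    and U :: "(real ^ 'd) set"
    and G :: "real ^ 'd \<Rightarrow> 'w \<Rightarrow> real ^ 'd"
    and \<rho> \<sigma> :: real
    and x0 :: "real ^ 'd"
    and T :: nat
  assumes r: "closed_convex_fun r"
    and g: "C1_smooth g" "\<rho>-lipschitz_on UNIV (gradient g)"
    and \<phi>: "\<phi> = (\<lambda>x. ereal (g x) + r x)"
    and min_exists: "\<exists>z. \<forall>y. \<phi> z \<le> \<phi> y"
    and P: "prob_space P"
    and A2: "open U" "edom r \<subseteq> U" "unbiased_oracle P U G g"
    and A3: "\<sigma> \<ge> 0" "variance_bounded P (edom r) G g \<sigma>"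
    and x0: "x0 \<in> edom r"
  shows "(\<forall>(\<rho>hat :: real) (\<alpha> :: nat \<Rightarrow> real) (M :: 'm measure) \<xi> tstar.
            \<rho>hat > \<rho> \<longrightarrow>
            (\<forall>t\<le>T. \<alpha> t \<in> {0<..1 / \<rho>hat}) \<longrightarrow>
            sgd_randomness M P T \<alpha> \<xi> tstar \<longrightarrow>
            (let f = (\<lambda>\<omega>. (norm (gradient (moreau_envelope (1 / \<rho>hat) \<phi>)
                             (prox_sgd r G \<alpha> x0 (\<lambda>t. \<xi> t \<omega>) (tstar \<omega>))))\<^sup>2)
             in integrable M f \<and>
                (\<integral>\<omega>. f \<omega> \<partial>M) \<le>
                  2 * \<rho>hat / (\<rho>hat - \<rho>) *
                  (((moreau_envelope (1 / \<rho>hat) \<phi> x0 - real_of_ereal (min_value \<phi>))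
                     + \<rho>hat * \<sigma>\<^sup>2 / 2 * (\<Sum>t\<le>T. (\<alpha> t)\<^sup>2))
                   / (\<Sum>t\<le>T. \<alpha> t))))
       \<and>
         (\<forall>(\<gamma> :: real) (\<alpha> :: nat \<Rightarrow> real) (M :: 'm measure) \<xi> tstar.
            \<rho> > 0 \<longrightarrow>
            \<gamma> \<in> {0<..1 / (2 * \<rho>)} \<longrightarrow>
            (\<forall>t\<le>T. \<alpha> t = \<gamma> / sqrt (real T + 1)) \<longrightarrow>
            sgd_randomness M P T \<alpha> \<xi> tstar \<longrightarrow>
            (let f = (\<lambda>\<omega>. (norm (gradient (moreau_envelope (1 / (2 * \<rho>)) \<phi>)
                             (prox_sgd r G \<alpha> x0 (\<lambda>t. \<xi> t \<omega>) (tstar \<omega>))))\<^sup>2)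
             in integrable M f \<and>
                (\<integral>\<omega>. f \<omega> \<partial>M) \<le>
                  4 * (((moreau_envelope (1 / (2 * \<rho>)) \<phi> x0 - real_of_ereal (min_value \<phi>))
                          + \<rho> * \<sigma>\<^sup>2 * \<gamma>\<^sup>2)
                        / (\<gamma> * sqrt (real T + 1)))))"
proof -
  have stochastic: "stochastic_composite_problem r g \<rho> \<rho>hat \<phi> P U G \<sigma>" if "\<rho> < \<rho>hat" for \<rho>hat
  proof -
    have "edom r \<noteq> {}" using x0 by blast
    then show ?thesis
      by (intro stochastic_composite_problem.intro composite_problem.intro
          stochastic_composite_problem_axioms.intro r g \<phi> min_exists P A2 A3 that)
  qed
  have bound: "integrable M f \<and> (\<integral>\<omega>. f \<omega> \<partial>M) \<le> 2 * \<rho>hat / (\<rho>hat - \<rho>) *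
      (((moreau_envelope (1 / \<rho>hat) \<phi> x0 - real_of_ereal (min_value \<phi>))
         + \<rho>hat * \<sigma>\<^sup>2 / 2 * (\<Sum>t\<le>T. (\<alpha> t)\<^sup>2)) / (\<Sum>t\<le>T. \<alpha> t))"
    if "\<rho> < \<rho>hat" "\<forall>t\<le>T. \<alpha> t \<in> {0<..1 / \<rho>hat}" "sgd_randomness M P T \<alpha> \<xi> tstar"
      and f: "f = (\<lambda>\<omega>. (norm (gradient (moreau_envelope (1 / \<rho>hat) \<phi>)
        (prox_sgd r G \<alpha> x0 (\<lambda>t. \<xi> t \<omega>) (tstar \<omega>))))\<^sup>2)"
    for \<rho>hat \<alpha> \<xi> tstar f and M :: "'m measure"
  proof -
    interpret stochastic_composite_problem r g \<rho> \<rho>hat \<phi> P U G \<sigma>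
      by (rule stochastic) fact
    have "0 < \<alpha> t \<and> \<alpha> t \<le> 1 / \<rho>hat" if "t \<le> T" for t
      using that \<open>\<forall>t\<le>T. \<alpha> t \<in> _\<close> by auto
    from expected_gradient_bound[OF x0 this \<open>sgd_randomness _ _ _ _ _ _\<close>]
    show ?thesis unfolding f gap_def by (rule conjI)
  qed
  show ?thesis
  proof (intro conjI allI impI)
    fix \<rho>hat \<alpha> \<xi> tstar and M :: "'m measure"
    assume "\<rho> < \<rho>hat" "\<forall>t\<le>T. \<alpha> t \<in> {0<..1 / \<rho>hat}" "sgd_randomness M P T \<alpha> \<xi> tstar"
    from bound[OF this refl]
    show "let f = (\<lambda>\<omega>. (norm (gradient (moreau_envelope (1 / \<rho>hat) \<phi>)
                  (prox_sgd r G \<alpha> x0 (\<lambda>t. \<xi> t \<omega>) (tstar \<omega>))))\<^sup>2)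
      in integrable M f \<and> (\<integral>\<omega>. f \<omega> \<partial>M) \<le> 2 * \<rho>hat / (\<rho>hat - \<rho>) *
        (((moreau_envelope (1 / \<rho>hat) \<phi> x0 - real_of_ereal (min_value \<phi>))
           + \<rho>hat * \<sigma>\<^sup>2 / 2 * (\<Sum>t\<le>T. (\<alpha> t)\<^sup>2)) / (\<Sum>t\<le>T. \<alpha> t))"
      unfolding Let_def .
  next
    fix \<gamma> \<alpha> \<xi> tstar and M :: "'m measure"
    assume \<rho>: "0 < \<rho>" and \<gamma>: "\<gamma> \<in> {0<..1 / (2 * \<rho>)}"
      and \<alpha>: "\<forall>t\<le>T. \<alpha> t = \<gamma> / sqrt (real T + 1)"
      and rnd: "sgd_randomness M P T \<alpha> \<xi> tstar"
    let ?n = "sqrt (real T + 1)"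
    have n: "1 \<le> ?n" "?n * ?n = real T + 1" by auto
    have "\<gamma> / ?n \<le> \<gamma>" "0 < \<gamma> / ?n"
      using \<gamma> n(1) by (auto simp: divide_le_eq mult_le_cancel_left1)
    then have step: "\<forall>t\<le>T. \<alpha> t \<in> {0<..1 / (2 * \<rho>)}" using \<alpha> \<gamma> by auto
    have "(\<Sum>t\<le>T. \<alpha> t) = (real T + 1) * (\<gamma> / ?n)" using \<alpha> by simp
    also have "\<dots> = \<gamma> * ?n" using n by (simp add: field_simps)
    finally have sum: "(\<Sum>t\<le>T. \<alpha> t) = \<gamma> * ?n" .
    have "(\<Sum>t\<le>T. (\<alpha> t)\<^sup>2) = (real T + 1) * (\<gamma> / ?n)\<^sup>2" using \<alpha> by simp
    also have "\<dots> = \<gamma>\<^sup>2" by (simp add: power_divide)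
    finally have sum_sq: "(\<Sum>t\<le>T. (\<alpha> t)\<^sup>2) = \<gamma>\<^sup>2" .
    have "2 * (2 * \<rho>) / (2 * \<rho> - \<rho>) = 4" "2 * \<rho> * \<sigma>\<^sup>2 / 2 = \<rho> * \<sigma>\<^sup>2" using \<rho> by auto
    then show "let f = (\<lambda>\<omega>. (norm (gradient (moreau_envelope (1 / (2 * \<rho>)) \<phi>)
                  (prox_sgd r G \<alpha> x0 (\<lambda>t. \<xi> t \<omega>) (tstar \<omega>))))\<^sup>2)
      in integrable M f \<and> (\<integral>\<omega>. f \<omega> \<partial>M) \<le>
        4 * (((moreau_envelope (1 / (2 * \<rho>)) \<phi> x0 - real_of_ereal (min_value \<phi>))
               + \<rho> * \<sigma>\<^sup>2 * \<gamma>\<^sup>2) / (\<gamma> * ?n))"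
      using bound[OF _ step rnd refl] \<rho> unfolding Let_def sum sum_sq by simp
  qed
qed

end
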